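(* Let all the assumptions on $\tau,\alpha,b,c,\mathcal A,g,H,y,\alpha_0,\bar\delta$ listed in the context hold, let $(u_0,u_1,u_2)\in\mathcal D(\mathcal A^{1/2})\times\mathcal D(\mathcal A^{1/2})\times X$, and let $u$ be the corresponding weak solution of $$\tau u_{ttt}+\alpha u_{tt}+c^2\mathcal A u+b\mathcal A u_t-\int_0^t g(t-s)\mathcal A u(s)\,ds=0,\qquad u(0)=u_0,\ u_t(0)=u_1,\ u_{tt}(0)=u_2 .$$ Then the energy $E(t)$ of $u$ (defined in the context) decays to zero as $t\to\infty$. Moreover, there exist positive constants $\tilde C,\tilde\beta,\tilde\kappa$ such that $$E(t)\le \tilde C\,y(\tilde\beta t+\tilde\kappa)\qquad\text{for all } t>0 .$$
   Context: $X$ is a real Hilbert space with inner product $(\cdot,\cdot)$ and norm $\|\cdot\|$; $\mathcal A$ is a positive self-adjoint operator on $X$ with dense domain; $\tau,\alpha,b,c>0$ are constants; $\mathbb R_+=[0,\infty)$. Assumptions. Put $\gamma=\alpha-\frac{c^2\tau}{b}$ and $G(t)=\int_0^t g(s)\,ds$. (1) $g\in C^1(\mathbb R_+)$, $g(t)>0$, $g(0)<\frac{b\alpha\gamma}{\tau^2}$ and $G(+\infty)<c^2$. (2) There is a convex, strictly increasing function $H\in C^1(\mathbb R_+)$ with $H(0)=0$ such that $g'(t)+H(g(t))\le 0$ for all $t>0$. (3) $y$ is the solution of $y'(t)+H(y(t))=0$, $y(0)=g(0)$, and there is $\alpha_0\in(0,1)$ with $y^{1-\alpha_0}\in L_1(\mathbb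 R_+)$. (4) There is $\bar\delta>0$ such that $H\in C^2(0,\bar\delta)$ and $x^2H''(x)-xH'(x)+H(x)\ge 0$ for all $x\in(0,\bar\delta)$. (5) There is $\lambda_0>0$ with $\|v\|\le\lambda_0\|\mathcal A^{1/2}v\|$ for all $v\in\mathcal D(\mathcal A^{1/2})$. (6) $\gamma>0$. Weak solution: a function $u\in C^1(\mathbb R_+;\mathcal D(\mathcal A^{1/2}))\cap C^2(\mathbb R_+;X)$ attaining the initial data and such that for every $v\in\mathcal D(\mathcal A^{1/2})$, in the sense of distributions in $t>0$, $$\tau\tfrac{d}{dt}(u_{tt},v)+\alpha(u_{tt},v)+c^2(\mathcal A^{1/2}u,\mathcal A^{1/2}v)+b(\mathcal A^{1/2}u_t,\mathcal A^{1/2}v)-\int_0^tg(t-s)(\mathcal A^{1/2}u(s),\mathcal A^{1/2}v)\,ds=0 .$$ Notation: $(g\circ h)(t)=\int_0^t g(t-s)\|h(t)-h(s)\|^2ds$, and $(\mathcal A u,u_t)$ means $(\mathcal A^{1/2}u,\mathcal A^{1/2}u_t)$. Energy: fix $k\in\left(\frac{c^2}{b},\frac{\alpha}{\tau}\right)$ and $\sigma\in(0,k)$ with $g(0)<(k-\sigma)(bk-c^2)$ (such $k,\sigma$ exist by (1) and (6)). Then $$\begin{aligned}E(t)=\;&b\|\mathcal A^{1/2}u_t\|^2+2c^2(\mathcal A u,u_t)+c^2k\|\mathcal A^{1/2}u\|^2+\tau\|u_{tt}+ku_t\|^2+k\tau\left(\tfrac{\alpha}{\tau}-k\right)\|u_t\|^2\\&+k\,g\circ\mathcal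 A^{1/2}u-kG(t)\|\mathcal A^{1/2}u\|^2+2\int_0^tg(t-s)\big(\mathcal A^{1/2}(u(t)-u(s)),\mathcal A^{1/2}u_t(t)\big)ds-2G(t)(\mathcal A u(t),u_t(t)).\end{aligned}$$ *)

theory Defs
  imports "HOL-Analysis.Analysis"
begin

section \<open>Unbounded operators on a real Hilbert space\<close>

text \<open>
  An unbounded operator is given by its domain \<open>D\<close> and a function \<open>A\<close> whose values outside
  \<open>D\<close> are irrelevant.
\<close>

definition linear_operator_on :: "'a::real_vector set \<Rightarrow> ('a \<Rightarrow> 'a) \<Rightarrow> bool" where
  "linear_operator_on D A \<longleftrightarrow>
     subspace D \<and> (\<forall>x\<in>D. \<forall>y\<in>D. A (x + y) = A x + A y) \<and> (\<forall>r. \<forall>x\<in>D. A (r *\<^sub>R x) = r *\<^sub>R A x)"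

definition adjoint_domain :: "'a::real_inner set \<Rightarrow> ('a \<Rightarrow> 'a) \<Rightarrow> 'a set" where
  "adjoint_domain D A = {y. \<exists>z. \<forall>x\<in>D. A x \<bullet> y = x \<bullet> z}"

text \<open>
  For densely defined \<open>A\<close> the vector \<open>z\<close> above is unique and equals \<open>A\<^sup>* y\<close>, so the last two
  conjuncts say exactly that \<open>A\<^sup>* = A\<close>, including equality of domains.
\<close>

definition self_adjoint_operator :: "'a::real_inner set \<Rightarrow> ('a \<Rightarrow> 'a) \<Rightarrow> bool" where
  "self_adjoint_operator D A \<longleftrightarrow>
     linear_operator_on D A \<and> closure D = UNIV \<and>
     adjoint_domain D A = D \<and> (\<forall>x\<in>D. \<forall>y\<in>D. A x \<bullet> y = x \<bullet> A y)"

definition positive_self_adjoint :: "'a::real_inner set \<Rightarrow> ('a \<Rightarrow> 'a) \<Rightarrow> bool" where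
  "positive_self_adjoint D A \<longleftrightarrow> self_adjoint_operator D A \<and> (\<forall>x\<in>D. A x \<bullet> x \<ge> 0)"

text \<open>
  \<open>(DS, S)\<close> is the (unique) positive self-adjoint operator with \<open>S\<^sup>2 = A\<close> as unbounded operators,
  i.e. \<open>S = A\<^sup>1\<^sup>/\<^sup>2\<close>.
\<close>

definition operator_sqrt ::
    "'a::real_inner set \<Rightarrow> ('a \<Rightarrow> 'a) \<Rightarrow> 'a set \<Rightarrow> ('a \<Rightarrow> 'a) \<Rightarrow> bool" where
  "operator_sqrt DA A DS S \<longleftrightarrow>
     positive_self_adjoint DS S \<and>
     DA = {x \<in> DS. S x \<in> DS} \<and> (\<forall>x\<in>DA. A x = S (S x))"

section \<open>Differentiability classes\<close>

text \<open>Derivatives are taken within the set \<open>I\<close>, hence one-sided at endpoints belonging to \<open>I\<close>.\<close>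

definition derivative_on :: "real set \<Rightarrow> (real \<Rightarrow> 'b::real_normed_vector) \<Rightarrow> real \<Rightarrow> 'b" where
  "derivative_on I f t = vector_derivative f (at t within I)"

primrec Ck_on :: "nat \<Rightarrow> real set \<Rightarrow> (real \<Rightarrow> 'b::real_normed_vector) \<Rightarrow> bool" where
  "Ck_on 0 I f \<longleftrightarrow> continuous_on I f"
| "Ck_on (Suc n) I f \<longleftrightarrow> f differentiable_on I \<and> Ck_on n I (derivative_on I f)"

text \<open>
  \<open>u \<in> C\<^sup>1(\<real>\<^sub>+; \<D>(S))\<close>, where \<open>\<D>(S)\<close> carries the graph norm, i.e. the norm of
  \<open>(v, S v)\<close> in the product space.
\<close>

definition C1_into_domain ::
    "'a::real_inner set \<Rightarrow> ('a \<Rightarrow> 'a) \<Rightarrow> (real \<Rightarrow> 'a) \<Rightarrow> bool" where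
  "C1_into_domain D S u \<longleftrightarrow>
     (\<forall>t\<ge>0. u t \<in> D \<and> derivative_on {0..} u t \<in> D \<and>
        ((\<lambda>s. (u s, S (u s))) has_vector_derivative
           (derivative_on {0..} u t, S (derivative_on {0..} u t))) (at t within {0..})) \<and>
     continuous_on {0..} (\<lambda>t. (derivative_on {0..} u t, S (derivative_on {0..} u t)))"

text \<open>Test functions: \<open>C\<^sub>c\<^sup>\<infinity>(0,\<infinity>)\<close>, extended by zero to the real line.\<close>

definition test_function :: "(real \<Rightarrow> real) \<Rightarrow> bool" where
  "test_function \<phi> \<longleftrightarrow>
     (\<forall>n. Ck_on n UNIV \<phi>) \<and> (\<exists>p q. 0 < p \<and> p \<le> q \<and> (\<forall>t. t \<notin> {p..q} \<longrightarrow> \<phi> t = 0))"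

section \<open>The Moore--Gibson--Thompson equation with memory\<close>

definition weak_solution ::
    "real \<Rightarrow> real \<Rightarrow> real \<Rightarrow> real \<Rightarrow> (real \<Rightarrow> real) \<Rightarrow> 'a::real_inner set \<Rightarrow> ('a \<Rightarrow> 'a)
      \<Rightarrow> 'a \<Rightarrow> 'a \<Rightarrow> 'a \<Rightarrow> (real \<Rightarrow> 'a) \<Rightarrow> bool" where
  "weak_solution \<tau> \<alpha> b c g DS S u0 u1 u2 u \<longleftrightarrow>
     (let ut = derivative_on {0..} u; utt = derivative_on {0..} ut in
       C1_into_domain DS S u \<and> Ck_on 2 {0..} u \<and>
       u 0 = u0 \<and> ut 0 = u1 \<and> utt 0 = u2 \<and>
       (\<forall>v\<in>DS. \<forall>\<phi>. test_function \<phi> \<longrightarrow>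
          - \<tau> * integral {0<..} (\<lambda>t. (utt t \<bullet> v) * deriv \<phi> t)
          + integral {0<..} (\<lambda>t.
              (\<alpha> * (utt t \<bullet> v) + c\<^sup>2 * (S (u t) \<bullet> S v) + b * (S (ut t) \<bullet> S v)
               - integral {0..t} (\<lambda>s. g (t - s) * (S (u s) \<bullet> S v))) * \<phi> t) = 0))"

definition memory_integral :: "(real \<Rightarrow> real) \<Rightarrow> real \<Rightarrow> real" where
  "memory_integral g t = integral {0..t} g"

definition memory_circ :: "(real \<Rightarrow> real) \<Rightarrow> (real \<Rightarrow> 'a::real_normed_vector) \<Rightarrow> real \<Rightarrow> real" where
  "memory_circ g h t = integral {0..t} (\<lambda>s. g (t - s) * (norm (h t - h s))\<^sup>2)"

text \<open>In the energy, \<open>(A u, u\<^sub>t)\<close> means \<open>(S u, S u\<^sub>t)\<close> with \<open>S = A\<^sup>1\<^sup>/\<^sup>2\<close>.\<close>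

definition energy ::
    "real \<Rightarrow> real \<Rightarrow> real \<Rightarrow> real \<Rightarrow> real \<Rightarrow> (real \<Rightarrow> real) \<Rightarrow> ('a::real_inner \<Rightarrow> 'a)
      \<Rightarrow> (real \<Rightarrow> 'a) \<Rightarrow> real \<Rightarrow> real" where
  "energy \<tau> \<alpha> b c k g S u t =
     (let ut = derivative_on {0..} u; utt = derivative_on {0..} ut; G = memory_integral g in
       b * (norm (S (ut t)))\<^sup>2 + 2 * c\<^sup>2 * (S (u t) \<bullet> S (ut t)) + c\<^sup>2 * k * (norm (S (u t)))\<^sup>2
       + \<tau> * (norm (utt t + k *\<^sub>R ut t))\<^sup>2 + k * \<tau> * (\<alpha> / \<tau> - k) * (norm (ut t))\<^sup>2
       + k * memory_circ g (\<lambda>s. S (u s)) t - k * G t * (norm (S (u t)))\<^sup>2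
       + 2 * integral {0..t} (\<lambda>s. g (t - s) * (S (u t - u s) \<bullet> S (ut t)))
       - 2 * G t * (S (u t) \<bullet> S (ut t)))"

end

theory Submission
  imports Defs
begin

text \<open>
  Write \<open>U = \<A>\<^sup>1\<^sup>/\<^sup>2 u\<close>. Averaging the equation over \<open>[t, t + h]\<close> makes it classical, with
  difference quotients of the solution as admissible test vectors; letting \<open>h \<rightarrow> 0\<close> justifies testing with
  \<open>u\<^sub>t\<^sub>t + k u\<^sub>t\<close>, and the energy dissipates \<open>\<parallel>u\<^sub>t\<^sub>t\<parallel>\<^sup>2\<close>, \<open>\<parallel>U\<^sub>t\<parallel>\<^sup>2\<close> and \<open>-g' \<circ> U\<close>.

  Testing with \<open>u\<close> gives \<open>c\<^sup>2 \<integral> \<parallel>U\<parallel>\<^sup>2 \<le> \<integral> (g * U, U) + C\<close>, and convolution with \<open>g\<close> has norm \<open>G(\<infinity>) < c\<^sup>2\<close>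
  on \<open>L\<^sup>2\<close>. So \<open>\<integral> \<parallel>U\<parallel>\<^sup>2 < \<infinity>\<close>, hence \<open>\<integral> E < \<infinity>\<close>, \<open>t E(t)\<close> is bounded because \<open>E\<close> decreases, and
  \<open>\<integral>\<^sub>0\<^sup>t \<parallel>U(t) - U(s)\<parallel>\<^sup>2 ds \<le> K\<close> uniformly in \<open>t\<close>.

  A Lyapunov function \<open>L\<close> equivalent to \<open>E\<close> satisfies \<open>L' \<le> -m E + C (g \<circ> U)\<close>. With \<open>Y(t) = y(\<beta> t + 1)\<close> and the
  nonincreasing weight \<open>\<xi> = H(Y)/Y\<close>, convexity gives \<open>\<xi> x \<le> H(x) + H(Y)\<close>, so
  \<open>\<xi> (g \<circ> U) \<le> (H(g) \<circ> U) + K H(Y) \<le> -E'/\<sigma> + K \<xi> Y\<close>, and \<open>\<xi> L + C E\<close> is compared with a multiple of \<open>Y\<close>.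
\<close>

section \<open>A copy of a Hilbert space that is a Banach space\<close>

text \<open>The first obstacle is regularity: the natural multiplier \<open>u_tt + k u_t\<close> is
  only known to lie in \<open>X\<close>, and \<open>u_ttt\<close> exists only when tested against
  fixed vectors. The operator therefore enters through its graph, a linear subspace that contains
  the difference quotients of the trajectory, and regularisation takes place in time, not in space.
  The second obstacle is the memory. The energy dissipates the kernel \<open>- g'\<close>, whereas
  decay requires control of the kernel \<open>g\<close>, and the two are linked only by a nonlinear
  inequality. Convexity is used separately at every kernel value, against the level
  \<open>Y(t)\<close>. The price is \<open>H(Y)\<close> times the total displacement, which is
  affordable only if that displacement is bounded uniformly in time; this is why integrability of
  the energy has to be known before any rate. The condition on \<open>g(0)\<close> is exactly what
  Young's inequality demands when the memory cross terms are absorbed, and \<open>\<sigma>\<close>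
  is the share of the \<open>- g'\<close> memory that survives as usable dissipation.\<close>

text \<open>The sort \<open>{real_inner, complete_space}\<close> is not contained in the class \<open>banach\<close>, which the integration
  theory requires. An instance can only be declared for a type constructor, hence the following copy.\<close>

typedef (overloaded) 'a hil = "UNIV :: 'a set" morphisms of_hil to_hil ..

setup_lifting type_definition_hil

instantiation hil :: (real_inner) real_vector
begin

lift_definition zero_hil :: "'a hil" is 0 .
lift_definition plus_hil :: "'a hil \<Rightarrow> 'a hil \<Rightarrow> 'a hil" is "(+)" .
lift_definition minus_hil :: "'a hil \<Rightarrow> 'a hil \<Rightarrow> 'a hil" is "(-)" .
lift_definition uminus_hil :: "'a hil \<Rightarrow> 'a hil" is "uminus" .
lift_definition scaleR_hil :: "real \<Rightarrow> 'a hil \<Rightarrow> 'a hil" is "scaleR" .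

instance
  by standard (transfer, simp add: algebra_simps; fail)+

end

instantiation hil :: (real_inner) real_inner
begin

lift_definition inner_hil :: "'a hil \<Rightarrow> 'a hil \<Rightarrow> real" is "inner" .
lift_definition norm_hil :: "'a hil \<Rightarrow> real" is "norm" .
lift_definition dist_hil :: "'a hil \<Rightarrow> 'a hil \<Rightarrow> real" is "dist" .
lift_definition sgn_hil :: "'a hil \<Rightarrow> 'a hil" is "sgn" .
definition uniformity_hil :: "('a hil \<times> 'a hil) filter" where
  "uniformity_hil = (INF e\<in>{0<..}. principal {(x, y). dist x y < e})"
definition open_hil :: "'a hil set \<Rightarrow> bool" where
  "open_hil U \<longleftrightarrow> (\<forall>x\<in>U. eventually (\<lambda>(x', y). x' = x \<longrightarrow> y \<in> U) uniformity)"

instance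
proof
  fix x y z :: "'a hil" and r :: real and U :: "'a hil set"
  show "(uniformity :: ('a hil \<times> 'a hil) filter) = (INF e\<in>{0<..}. principal {(x, y). dist x y < e})"
    by (rule uniformity_hil_def)
  show "open U = (\<forall>x\<in>U. eventually (\<lambda>(x', y). x' = x \<longrightarrow> y \<in> U) uniformity)"
    by (rule open_hil_def)
  show "dist x y = norm (x - y)" by transfer (rule dist_norm)
  show "sgn x = x /\<^sub>R norm x" by transfer (rule sgn_div_norm)
  show "x \<bullet> y = y \<bullet> x" by transfer (rule inner_commute)
  show "(x + y) \<bullet> z = x \<bullet> z + y \<bullet> z" by transfer (rule inner_add_left)
  show "r *\<^sub>R x \<bullet> y = r * (x \<bullet> y)" by transfer (rule inner_scaleR_left)
  show "0 \<le> x \<bullet> x" by transfer (rule inner_ge_zero)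
  show "x \<bullet> x = 0 \<longleftrightarrow> x = 0" by transfer (rule inner_eq_zero_iff)
  show "norm x = sqrt (x \<bullet> x)" by transfer (rule norm_eq_sqrt_inner)
qed

end

lemma of_hil_simps [simp]:
  "of_hil (x + y) = of_hil x + of_hil y" "of_hil (r *\<^sub>R x) = r *\<^sub>R of_hil x"
  "to_hil (a + b) = to_hil a + to_hil b" "to_hil (r *\<^sub>R a) = r *\<^sub>R to_hil a"
  "to_hil (a - b) = to_hil a - to_hil b" 
  "norm (to_hil a) = norm a" "to_hil a \<bullet> to_hil b = a \<bullet> b" "norm (of_hil x) = norm x"
  by (transfer; simp)+

lemma to_hil_0: "to_hil 0 = 0"
  by (simp add: zero_hil_def)

lemma bounded_linear_of_hil: "bounded_linear of_hil"
  by (rule bounded_linear_intro[where K=1]) auto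

lemma bounded_linear_to_hil: "bounded_linear to_hil"
  by (rule bounded_linear_intro[where K=1]) auto

instance hil :: ("{real_inner, complete_space}") banach
proof
  fix X :: "nat \<Rightarrow> 'a hil"
  assume "Cauchy X"
  then have "Cauchy (\<lambda>n. of_hil (X n))"
    by (rule bounded_linear.Cauchy[OF bounded_linear_of_hil])
  then obtain l where "(\<lambda>n. of_hil (X n)) \<longlonglongrightarrow> l"
    by (auto simp: Cauchy_convergent_iff convergent_def)
  then have "(\<lambda>n. to_hil (of_hil (X n))) \<longlonglongrightarrow> to_hil l"
    by (rule bounded_linear.tendsto[OF bounded_linear_to_hil])
  then show "convergent X"
    by (auto simp: convergent_def of_hil_inverse)
qed

section \<open>Test functions\<close>

text \<open>The powers of \<open>x\<close> in the denominator make the family closed under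
  differentiation up to linear combinations, so a single limit at 0, taken for every
  \<open>k\<close>, yields smoothness of all orders.\<close>

definition bump :: "nat \<Rightarrow> real \<Rightarrow> real" where
  "bump k x = (if x \<le> 0 then 0 else exp (- 1 / x) / x ^ k)"

lemma bump_tendsto_0: "(bump k \<longlongrightarrow> 0) (at_right 0)"
proof -
  have "((\<lambda>x::real. x ^ k / exp x) \<longlongrightarrow> 0) at_top"
    by (rule tendsto_power_div_exp_0)
  then have "((\<lambda>x::real. inverse x ^ k / exp (inverse x)) \<longlongrightarrow> 0) (at_right 0)"
    by (rule filterlim_compose) (rule filterlim_inverse_at_top_right)
  moreover have "eventually (\<lambda>x. inverse x ^ k / exp (inverse x) = bump k x) (at_right (0::real))"
    using eventually_at_right_less by (rule eventually_mono)
      (simp add: bump_def exp_minus field_simps power_inverse)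
  ultimately show ?thesis
    by (rule Lim_transform_eventually)
qed

text \<open>Only 0 is delicate: there the right difference quotient of \<open>bump k\<close> is
  \<open>bump (Suc k)\<close>, which tends to 0, and the left one vanishes.\<close>

lemma bump_derivative:
  "(bump k has_real_derivative bump (k + 2) x - k * bump (k + 1) x) (at x)"
proof -
  consider "x < 0" | "x = 0" | "x > 0" by linarith
  then show ?thesis
  proof cases
    case 1
    have "((\<lambda>_. 0) has_real_derivative 0) (at x)" by simp
    then have "(bump k has_real_derivative 0) (at x)"
      by (rule has_field_derivative_transform_within_open[where S="{..<0}"])
        (use 1 in \<open>auto simp: bump_def\<close>)
    then show ?thesis using 1 by (simp add: bump_def)
  next
    case 2
    have "((\<lambda>h. (bump k (0 + h) - bump k 0) / h) \<longlongrightarrow> 0) (at_right 0)"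
    proof (rule Lim_transform_eventually[OF bump_tendsto_0[of "Suc k"]])
      show "eventually (\<lambda>x. bump (Suc k) x = (bump k (0 + x) - bump k 0) / x) (at_right 0)"
        using eventually_at_right_less by (rule eventually_mono) (simp add: bump_def)
    qed
    moreover have "((\<lambda>h. (bump k (0 + h) - bump k 0) / h) \<longlongrightarrow> 0) (at_left 0)"
    proof (rule Lim_transform_eventually[OF tendsto_const])
      show "eventually (\<lambda>x. 0 = (bump k (0 + x) - bump k 0) / x) (at_left (0::real))"
        unfolding eventually_at_filter by (simp add: bump_def)
    qed
    ultimately have "((\<lambda>h. (bump k (0 + h) - bump k 0) / h) \<longlongrightarrow> 0) (at 0)"
      using filterlim_split_at by blast
    then show ?thesis
      using 2 by (simp add: DERIV_def bump_def)
  next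
    case 3
    have e: "((\<lambda>x. exp (- 1 / x)) has_real_derivative exp (- 1 / x) / x\<^sup>2) (at x)"
      using 3 by (auto intro!: derivative_eq_intros simp: power2_eq_square)
    have "real k * x ^ (k - 1) = k * (x ^ k / x)"
      using 3 by (cases k) auto
    then have p: "((\<lambda>x. x ^ k) has_real_derivative k * (x ^ k / x)) (at x)"
      using DERIV_pow[of k x] by simp
    have "((\<lambda>x. exp (- 1 / x) / x ^ k) has_real_derivative bump (k + 2) x - k * bump (k + 1) x) (at x)"
    proof (rule DERIV_cong[OF DERIV_divide[OF e p]])
      have *: "(E / x\<^sup>2 * z - E * (k * (z / x))) / (z * z) = E / (z * x\<^sup>2) - k * (E / (z * x))"
        if "z \<noteq> 0" for E z
        using 3 that by (simp add: field_simps power2_eq_square)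
      show "(exp (- 1 / x) / x\<^sup>2 * x ^ k - exp (- 1 / x) * (k * (x ^ k / x))) / (x ^ k * x ^ k) =
          bump (k + 2) x - k * bump (k + 1) x"
        using 3 by (subst *) (simp_all add: bump_def power2_eq_square mult_ac)
    qed (use 3 in simp)
    then show ?thesis
      by (rule has_field_derivative_transform_within_open[where S="{0<..}"])
        (use 3 in \<open>auto simp: bump_def\<close>)
  qed
qed

text \<open>Smoothness of all orders follows by induction once the class contains a derivative of
  each member. Affine arguments cover translations and the reflected factor
  \<open>bump 0 (e - x)\<close>; differences arise from the constant factor -1.\<close>

inductive_set bump_algebra :: "(real \<Rightarrow> real) set" where
  bump: "(\<lambda>x. bump k (p * x + q)) \<in> bump_algebra"
| const: "(\<lambda>x. c) \<in> bump_algebra"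
| add: "f \<in> bump_algebra \<Longrightarrow> g \<in> bump_algebra \<Longrightarrow> (\<lambda>x. f x + g x) \<in> bump_algebra"
| mult: "f \<in> bump_algebra \<Longrightarrow> g \<in> bump_algebra \<Longrightarrow> (\<lambda>x. f x * g x) \<in> bump_algebra"

lemma bump_algebra_derivative:
  "f \<in> bump_algebra \<Longrightarrow> \<exists>f'\<in>bump_algebra. \<forall>x. (f has_real_derivative f' x) (at x)"
proof (induction rule: bump_algebra.induct)
  case (bump k p q)
  show ?case
  proof (intro bexI allI)
    fix x
    show "((\<lambda>x. bump k (p * x + q)) has_real_derivative
        p * (bump (k + 2) (p * x + q) + (- real k) * bump (k + 1) (p * x + q))) (at x)"
      by (rule DERIV_cong[OF DERIV_chain2[OF bump_derivative]])
        (auto intro!: derivative_eq_intros simp: algebra_simps)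
    show "(\<lambda>x. p * (bump (k + 2) (p * x + q) + (- real k) * bump (k + 1) (p * x + q))) \<in> bump_algebra"
      by (intro bump_algebra.intros)
  qed
next
  case (const c)
  then show ?case by (intro bexI[of _ "\<lambda>_. 0"]) (auto intro: bump_algebra.intros)
next
  case (add f g)
  then obtain f' g' where "f' \<in> bump_algebra" "g' \<in> bump_algebra"
    "\<forall>x. (f has_real_derivative f' x) (at x)" "\<forall>x. (g has_real_derivative g' x) (at x)"
    by blast
  then show ?case
    by (intro bexI[of _ "\<lambda>x. f' x + g' x"]) (auto intro: bump_algebra.intros derivative_intros)
next
  case (mult f g)
  then obtain f' g' where "f' \<in> bump_algebra" "g' \<in> bump_algebra"
    "\<forall>x. (f has_real_derivative f' x) (at x)" "\<forall>x. (g has_real_derivative g' x) (at x)"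
    by blast
  then show ?case using mult.hyps
    by (intro bexI[of _ "\<lambda>x. f x * g' x + f' x * g x"])
      (auto intro: bump_algebra.intros DERIV_mult')
qed

lemma Ck_on_Suc_UNIV:
  fixes f :: "real \<Rightarrow> real"
  assumes "\<And>x. (f has_real_derivative f' x) (at x)" "Ck_on n UNIV f'"
  shows "Ck_on (Suc n) UNIV f"
proof -
  have "derivative_on UNIV f = f'"
    using assms(1) by (auto simp: derivative_on_def fun_eq_iff
        has_real_derivative_iff_has_vector_derivative vector_derivative_at)
  moreover have "f differentiable_on UNIV"
    using assms(1) by (auto simp: differentiable_on_def real_differentiable_def)
  ultimately show ?thesis using assms(2) by simp
qed

lemma bump_algebra_Ck_on: "f \<in> bump_algebra \<Longrightarrow> Ck_on n UNIV f"
proof (induction n arbitrary: f)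
  case 0
  then show ?case
    using bump_algebra_derivative
    by (metis Ck_on.simps(1) DERIV_isCont continuous_at_imp_continuous_on)
next
  case (Suc n)
  then show ?case
    using bump_algebra_derivative Ck_on_Suc_UNIV by blast
qed

text \<open>The test functions are \<open>P (t - a) - P (t - b)\<close>, where \<open>P\<close> is a primitive of the bump
  \<open>bump 0 x * bump 0 (e - x)\<close> on \<open>(0, e)\<close>: their derivatives compare averages near \<open>a\<close> and \<open>b\<close>.\<close>

lemma test_function_exists:
  assumes e: "0 < e" and ab: "0 < a" "a \<le> b"
  defines "\<rho> \<equiv> \<lambda>x. bump 0 x * bump 0 (e - x)"
  obtains \<phi> where "test_function \<phi>" "\<And>t. (\<phi> has_real_derivative \<rho> (t - a) - \<rho> (t - b)) (at t)"
    "\<And>t. t \<notin> {a..b + e} \<Longrightarrow> \<phi> t = 0"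
proof -
  have \<rho>_cont: "continuous_on A \<rho>" for A
  proof -
    have "continuous_on UNIV (bump 0)"
      using bump_derivative DERIV_isCont continuous_at_imp_continuous_on by blast
    then show ?thesis
      unfolding \<rho>_def by (intro continuous_on_mult; elim continuous_on_compose2) (auto intro!: continuous_intros)
  qed
  have \<rho>0: "\<rho> x = 0" if "x \<notin> {0<..<e}" for x
    using that by (auto simp: \<rho>_def bump_def)
  \<comment> \<open>Starting at -1 makes 0 an interior point, so the derivative there is two-sided;
    left of 0 the primitive vanishes.\<close>
  define P where "P x = integral {-1..x} \<rho>" for x
  have P: "(P has_real_derivative \<rho> x) (at x)" for x
  proof (cases "x > -1")
    case True
    have "((\<lambda>u. integral {-1..u} \<rho>) has_vector_derivative \<rho> x) (at x within {-1..x+1})"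
      by (rule integral_has_vector_derivative[OF \<rho>_cont]) (use True in auto)
    moreover have "at x within {-1..x+1} = at x"
      by (rule at_within_interior) (use True in auto)
    ultimately show ?thesis unfolding P_def[abs_def]
      by (simp add: has_real_derivative_iff_has_vector_derivative)
  next
    case False
    have "((\<lambda>_. 0) has_real_derivative 0) (at x)" by simp
    then have "(P has_real_derivative 0) (at x)"
    proof (rule has_field_derivative_transform_within_open[where S="{..<0}"])
      show "0 = P z" if "z \<in> {..<0}" for z
        unfolding P_def using that by (intro integral_unique[symmetric] has_integral_is_0) (auto simp: \<rho>0)
    qed (use False in auto)
    then show ?thesis using False by (simp add: \<rho>0)
  qed
  have P0: "P x = 0" if "x \<le> 0" for x
    unfolding P_def using that by (intro integral_unique has_integral_is_0) (auto simp: \<rho>0)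
  have Pe: "P x = P e" if "x \<ge> e" for x
  proof -
    have "P x = P e + integral {e..x} \<rho>"
      unfolding P_def using that e
      by (intro Henstock_Kurzweil_Integration.integral_combine[symmetric] integrable_continuous_interval \<rho>_cont) auto
    moreover have "integral {e..x} \<rho> = 0"
      by (intro integral_unique has_integral_is_0) (auto simp: \<rho>0)
    ultimately show ?thesis by simp
  qed
  define \<phi> where "\<phi> t = P (t - a) - P (t - b)" for t
  have d: "(\<phi> has_real_derivative \<rho> (t - a) - \<rho> (t - b)) (at t)" for t
    unfolding \<phi>_def[abs_def]
    by (rule DERIV_cong[OF DERIV_diff[OF DERIV_chain2[OF P] DERIV_chain2[OF P]]])
      (auto intro!: derivative_eq_intros)
  have sup: "\<phi> t = 0" if "t \<notin> {a..b + e}" for t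
    using that ab Pe[of "t - a"] Pe[of "t - b"] by (cases "t < a") (auto simp: \<phi>_def P0)
  have "Ck_on n UNIV \<phi>" for n
  proof (cases n)
    case 0
    then show ?thesis using d by (auto intro!: continuous_at_imp_continuous_on DERIV_isCont)
  next
    case (Suc m)
    have shape: "\<rho> (t - s) = bump 0 (1 * t + (- s)) * bump 0 ((- 1) * t + (e + s))" for t s
      by (simp add: \<rho>_def algebra_simps)
    have "(\<lambda>t. \<rho> (t - a) - \<rho> (t - b)) = (\<lambda>t. \<rho> (t - a) + (- 1) * \<rho> (t - b))" by auto
    also have "\<dots> \<in> bump_algebra"
      unfolding shape by (intro bump_algebra.intros)
    finally show ?thesis
      using Suc Ck_on_Suc_UNIV[OF d] bump_algebra_Ck_on by blast
  qed
  then have "test_function \<phi>"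
    unfolding test_function_def using sup ab e
    by (intro conjI allI exI[of _ a] exI[of _ "b + e"]) auto
  then show ?thesis using d sup that by blast
qed

section \<open>Forward means and convolutions on the half line\<close>

lemma at_within_atLeastAtMost_Suc:
  fixes t :: real
  shows "0 \<le> t \<Longrightarrow> at t within {0..t + 1} = at t within {0..}"
  by (rule at_within_nhd[where S = "{..<t + 1}"]) auto

lemma integral_has_vector_derivative_atLeast:
  fixes f :: "real \<Rightarrow> 'b::banach"
  assumes "continuous_on {0..} f" "0 \<le> t"
  shows "((\<lambda>t. integral {0..t} f) has_vector_derivative f t) (at t within {0..})"
proof -
  have "continuous_on {0..t + 1} f"
    using assms by (auto intro: continuous_on_subset)
  from integral_has_vector_derivative[OF this, of t] show ?thesis
    using assms by (simp add: at_within_atLeastAtMost_Suc)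
qed

lemma ftc_atLeast:
  fixes f :: "real \<Rightarrow> 'b::banach"
  assumes "\<And>t. 0 \<le> t \<Longrightarrow> (f has_vector_derivative f' t) (at t within {0..})" "0 \<le> a" "a \<le> b"
  shows "(f' has_integral f b - f a) {a..b}"
  using assms
  by (intro fundamental_theorem_of_calculus has_vector_derivative_within_subset[of f _ _ "{0..}" "{a..b}"]) auto

lemma nonincreasing_atLeast:
  fixes f :: "real \<Rightarrow> real"
  assumes "\<And>t. 0 \<le> t \<Longrightarrow> (f has_vector_derivative f' t) (at t within {0..})"
    "\<And>t. 0 \<le> t \<Longrightarrow> f' t \<le> 0" "0 \<le> a" "a \<le> b"
  shows "f b \<le> f a"
proof -
  have "f b - f a \<le> 0"
    by (rule has_integral_le[OF ftc_atLeast[of f f'] has_integral_0]) (use assms in auto)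
  then show ?thesis by simp
qed

text \<open>The mean over \<open>[t, t + h]\<close>, rescaled to a fixed interval: in this form it
  is also defined at \<open>h = 0\<close>, where it equals \<open>q t\<close>, and it is jointly
  continuous up to there.\<close>

definition forward_mean :: "(real \<Rightarrow> 'b::real_normed_vector) \<Rightarrow> real \<Rightarrow> real \<Rightarrow> 'b" where
  "forward_mean q h t = integral {0..1} (\<lambda>\<theta>. q (t + h * \<theta>))"

lemma forward_mean_0 [simp]: "forward_mean q 0 t = q t" for q :: "real \<Rightarrow> 'b::banach"
  by (simp add: forward_mean_def)

lemma continuous_on_forward_mean:
  fixes q :: "real \<Rightarrow> 'b::banach"
  assumes "continuous_on {0..} q"
  shows "continuous_on ({0..} \<times> {0..}) (\<lambda>(h, t). forward_mean q h t)"
proof -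
  have "continuous_on (({0..} \<times> {0..}) \<times> cbox 0 1) (\<lambda>(x, \<theta>). q (snd x + fst x * \<theta>))"
    unfolding split_beta
    by (rule continuous_on_compose2[OF assms]) (auto intro!: continuous_intros)
  from integral_continuous_on_param[OF this] show ?thesis
    by (simp add: forward_mean_def split_beta)
qed

lemma forward_mean_derivative:
  fixes Q :: "real \<Rightarrow> 'b::banach"
  assumes "\<And>t. 0 \<le> t \<Longrightarrow> (Q has_vector_derivative q t) (at t within {0..})" "0 \<le> t" "0 < h"
  shows "forward_mean q h t = (Q (t + h) - Q t) /\<^sub>R h"
proof -
  have "((\<lambda>\<theta>. Q (t + h * \<theta>) /\<^sub>R h) has_vector_derivative q (t + h * \<theta>)) (at \<theta> within {0..1})"
    if "\<theta> \<in> {0..1}" for \<theta>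
  proof -
    have "((\<lambda>\<theta>. t + h * \<theta>) has_vector_derivative h) (at \<theta> within {0..1})"
      by (auto intro!: derivative_eq_intros)
    moreover have "(Q has_vector_derivative q (t + h * \<theta>)) (at (t + h * \<theta>) within (\<lambda>\<theta>. t + h * \<theta>) ` {0..1})"
      using assms that by (intro has_vector_derivative_within_subset[OF assms(1)]) auto
    ultimately have "((Q \<circ> (\<lambda>\<theta>. t + h * \<theta>)) has_vector_derivative h *\<^sub>R q (t + h * \<theta>)) (at \<theta> within {0..1})"
      by (rule vector_diff_chain_within)
    then have "((\<lambda>\<theta>. (1 / h) *\<^sub>R (Q \<circ> (\<lambda>\<theta>. t + h * \<theta>)) \<theta>) has_vector_derivative
        (1 / h) *\<^sub>R h *\<^sub>R q (t + h * \<theta>)) (at \<theta> within {0..1})"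
      by (rule bounded_linear.has_vector_derivative[OF bounded_linear_scaleR_right])
    then show ?thesis using assms by (simp add: divide_inverse o_def)
  qed
  from fundamental_theorem_of_calculus[OF _ this]
  show ?thesis unfolding forward_mean_def
    by (intro integral_unique) (simp add: scaleR_diff_right)
qed

lemma forward_mean_has_vector_derivative:
  fixes q :: "real \<Rightarrow> 'b::banach"
  assumes "continuous_on {0..} q" "0 \<le> t" "0 < h"
  shows "(forward_mean q h has_vector_derivative (q (t + h) - q t) /\<^sub>R h) (at t within {0..})"
proof -
  let ?Q = "\<lambda>t. integral {0..t} q"
  have Q: "(?Q has_vector_derivative q t) (at t within {0..})" if "0 \<le> t" for t
    using integral_has_vector_derivative_atLeast assms(1) that by blast
  have "((\<lambda>t. t + h) has_vector_derivative 1) (at t within {0..})"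
    by (auto intro!: derivative_eq_intros)
  moreover have "(?Q has_vector_derivative q (t + h)) (at (t + h) within (\<lambda>t. t + h) ` {0..})"
    using assms by (intro has_vector_derivative_within_subset[OF Q]) auto
  ultimately have "((?Q \<circ> (\<lambda>t. t + h)) has_vector_derivative 1 *\<^sub>R q (t + h)) (at t within {0..})"
    by (rule vector_diff_chain_within)
  then have "((\<lambda>t. (?Q (t + h) - ?Q t) /\<^sub>R h) has_vector_derivative (q (t + h) - q t) /\<^sub>R h) (at t within {0..})"
    using Q[OF assms(2)]
    by (intro bounded_linear.has_vector_derivative[OF bounded_linear_scaleR_right] has_vector_derivative_diff)
      (simp_all add: o_def)
  then show ?thesis
  proof (rule has_vector_derivative_transform[rotated 2])
    show "forward_mean q h s = (?Q (s + h) - ?Q s) /\<^sub>R h" if "s \<in> {0..}" for s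
      using that assms by (intro forward_mean_derivative Q) auto
  qed (use assms in auto)
qed

text \<open>Integrate the identity over \<open>[0, t]\<close>, let \<open>h\<close> tend to 0 by
  joint continuity, and differentiate again. Identities for forward means are transferred to the
  trajectory in this way.\<close>

lemma derivative_limit:
  fixes X Y :: "real \<Rightarrow> real \<Rightarrow> real"
  assumes X: "continuous_on ({0..} \<times> {0..}) (\<lambda>(h, t). X h t)"
    and Y: "continuous_on ({0..} \<times> {0..}) (\<lambda>(h, t). Y h t)"
    and d: "\<And>h t. 0 < h \<Longrightarrow> 0 \<le> t \<Longrightarrow> (X h has_vector_derivative Y h t) (at t within {0..})"
    and t: "0 \<le> t"
  shows "(X 0 has_vector_derivative Y 0 t) (at t within {0..})"
proof -
  have eq: "X 0 t = X 0 0 + integral {0..t} (Y 0)" if t: "0 \<le> t" for t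
  proof -
    define Z where "Z h = X h t - X h 0 - integral {0..t} (Y h)" for h
    have "continuous_on {0..} (\<lambda>h. integral (cbox 0 t) (Y h))"
      by (rule integral_continuous_on_param) (rule continuous_on_subset[OF Y], auto)
    moreover have "continuous_on {0..} (\<lambda>h. X h s)" if "0 \<le> s" for s
      using that by (intro continuous_on_compose2[OF X, of "{0..}" "\<lambda>h. (h, s)", simplified])
        (auto intro!: continuous_intros)
    ultimately have "continuous_on {0..} Z"
      unfolding Z_def[abs_def] using t by (intro continuous_intros) auto
    then have "(Z \<longlongrightarrow> Z 0) (at 0 within {0..})"
      by (auto simp: continuous_on_def)
    then have "(Z \<longlongrightarrow> Z 0) (at_right 0)"
      by (rule tendsto_within_subset) auto
    moreover have "eventually (\<lambda>h. Z h = 0) (at_right 0)"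
      using eventually_at_right_less
      by (rule eventually_mono) (use t in \<open>auto simp: Z_def integral_unique[OF ftc_atLeast[OF d]]\<close>)
    ultimately have "Z 0 = 0"
      by (metis tendsto_eventually tendsto_unique trivial_limit_at_right_real)
    then show ?thesis by (simp add: Z_def)
  qed
  have "continuous_on {0..} (Y 0)"
    by (intro continuous_on_compose2[OF Y, of "{0..}" "\<lambda>t. (0, t)", simplified])
      (auto intro!: continuous_intros)
  then have "((\<lambda>t. X 0 0 + integral {0..t} (Y 0)) has_vector_derivative 0 + Y 0 t) (at t within {0..})"
    by (intro has_vector_derivative_add has_vector_derivative_const
        integral_has_vector_derivative_atLeast t)
  then show ?thesis
    by (intro has_vector_derivative_transform[OF _ eq]) (use t in auto)
qed

section \<open>Convolution with a kernel on the half line\<close>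

definition convol :: "(real \<Rightarrow> real) \<Rightarrow> (real \<Rightarrow> 'b::real_normed_vector) \<Rightarrow> real \<Rightarrow> 'b" where
  "convol g f t = integral {0..t} (\<lambda>s. g (t - s) *\<^sub>R f s)"

lemma continuous_on_convol_integrand:
  fixes f :: "real \<Rightarrow> 'b::real_normed_vector"
  assumes "continuous_on {0..} g" "continuous_on {0..} f"
  shows "continuous_on {0..t} (\<lambda>s. g (t - s) *\<^sub>R f s)"
  by (intro continuous_intros continuous_on_compose2[OF assms(1)] continuous_on_compose2[OF assms(2)]) auto

lemma convol_integrable:
  fixes f :: "real \<Rightarrow> 'b::banach"
  assumes "continuous_on {0..} g" "continuous_on {0..} f"
  shows "(\<lambda>s. g (t - s) *\<^sub>R f s) integrable_on {0..t}"
  by (intro integrable_continuous_interval continuous_on_convol_integrand assms)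

text \<open>The substitution \<open>s = t * \<theta>\<close> turns the moving endpoint into a
  parameter of the integrand.\<close>

lemma continuous_on_convol:
  fixes f :: "real \<Rightarrow> 'b::banach"
  assumes "continuous_on {0..} g" "continuous_on {0..} f"
  shows "continuous_on {0..} (convol g f)"
proof -
  have scale: "convol g f t = t *\<^sub>R integral {0..1} (\<lambda>\<theta>. g (t - t * \<theta>) *\<^sub>R f (t * \<theta>))" if "t \<in> {0..}" for t
  proof (cases "t = 0")
    case False
    then have "(\<lambda>x. x / t) ` {0..t} = {0..1}"
      using that by (simp add: image_divide_atLeastAtMost)
    then show ?thesis
      using integral_stretch_real[OF False, of 0 t "\<lambda>s. g (t - s) *\<^sub>R f s"] that False
      by (simp add: convol_def)
  qed (simp add: convol_def)
  have "continuous_on ({0..} \<times> cbox 0 1) (\<lambda>(t, \<theta>). g (t - t * \<theta>) *\<^sub>R f (t * \<theta>))"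
    unfolding split_beta
    by (intro continuous_intros continuous_on_compose2[OF assms(1)] continuous_on_compose2[OF assms(2)])
      (auto simp: mult_left_le)
  from integral_continuous_on_param[OF this] show ?thesis
    by (subst continuous_on_cong[OF refl scale]) (auto intro!: continuous_intros)
qed

text \<open>Kernel argument and upper limit become the two variables of \<open>\<Phi>\<close>. Both
  partial derivatives exist, the one in the upper limit is jointly continuous, and the chain rule
  along the diagonal gives the boundary term and the convolution with \<open>g'\<close>.\<close>

lemma convol_has_vector_derivative:
  fixes f :: "real \<Rightarrow> 'b::banach"
  assumes g: "\<And>r. 0 \<le> r \<Longrightarrow> (g has_vector_derivative g' r) (at r within {0..})"
    and g': "continuous_on {0..} g'" and f: "continuous_on {0..} f" and t: "0 \<le> t"
  shows "(convol g f has_vector_derivative g 0 *\<^sub>R f t + convol g' f t) (at t within {0..})"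
proof -
  \<comment> \<open>Off the diagonal the kernel is evaluated at negative arguments, so
    \<open>g\<close> is continued there by its tangent at 0, which keeps it continuously
    differentiable.\<close>
  define ge where "ge r = (if r \<in> {0..} then g r else g 0 + g' 0 * r)" for r
  define ge' where "ge' r = g' (max 0 r)" for r
  have ge: "(ge has_vector_derivative ge' r) (at r within S)" for r S
  proof -
    have "(ge has_vector_derivative (if r \<in> {0..} then g' r else g' 0)) (at r within {0..} \<union> {..0})"
      unfolding ge_def
    proof (rule has_vector_derivative_If_within_closures[where T="{..0}"])
      show "((\<lambda>r. g 0 + g' 0 * r) has_vector_derivative g' 0) (at r within {..0} \<union> closure {0..} \<inter> closure {..0})"
        by (auto intro!: derivative_eq_intros)
      show "(g has_vector_derivative g' r) (at r within {0..} \<union> closure {0..} \<inter> closure {..0})"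
        if "r \<in> {0..} \<union> closure {0..} \<inter> closure {..0}"
        using g[of r] that by (simp add: Un_absorb2)
    qed auto
    moreover have "{0..} \<union> {..0::real} = UNIV" by auto
    moreover have "(if r \<in> {0..} then g' r else g' 0) = ge' r" by (auto simp: ge'_def max_def)
    ultimately show ?thesis
      using has_vector_derivative_at_within by metis
  qed
  have ge_cont: "continuous_on S ge" for S
    using ge by (rule continuous_on_vector_derivative)
  have ge'_cont: "continuous_on S ge'" for S
    unfolding ge'_def by (intro continuous_on_compose2[OF g'] continuous_intros) auto
  define \<Phi> where "\<Phi> t x = integral {0..x} (\<lambda>s. ge (t - s) *\<^sub>R f s)" for t x
  have int: "continuous_on {0..} (\<lambda>s. ge (t - s) *\<^sub>R f s)" for t
    by (intro continuous_intros continuous_on_compose2[OF ge_cont] f) auto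
  have x: "(\<Phi> t has_derivative blinfun_apply (blinfun_scaleR_left (ge (t - x) *\<^sub>R f x))) (at x within {0..})"
    if "x \<in> {0..}" for t x
    using integral_has_vector_derivative_atLeast[OF int] that
    by (simp add: \<Phi>_def[abs_def] has_vector_derivative_def)
  have "((\<lambda>u. integral (cbox 0 t) (\<lambda>s. ge (u - s) *\<^sub>R f s)) has_vector_derivative
      integral (cbox 0 t) (\<lambda>s. ge' (t - s) *\<^sub>R f s)) (at t within {0..})"
  proof (rule leibniz_rule_vector_derivative)
    show "((\<lambda>u. ge (u - s) *\<^sub>R f s) has_vector_derivative ge' (u - s) *\<^sub>R f s) (at u within {0..})" for u s
    proof -
      have "((ge \<circ> (\<lambda>u. u - s)) has_vector_derivative 1 *\<^sub>R ge' (u - s)) (at u within {0..})"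
        by (rule vector_diff_chain_within[OF _ ge]) (auto intro!: derivative_eq_intros)
      then have "((\<lambda>u. (ge \<circ> (\<lambda>u. u - s)) u *\<^sub>R f s) has_vector_derivative (1 *\<^sub>R ge' (u - s)) *\<^sub>R f s) (at u within {0..})"
        by (rule bounded_linear.has_vector_derivative[OF bounded_linear_scaleR_left])
      then show ?thesis by simp
    qed
    show "(\<lambda>s. ge (u - s) *\<^sub>R f s) integrable_on cbox 0 t" for u
      unfolding cbox_interval by (intro integrable_continuous_interval continuous_on_subset[OF int]) auto
    show "continuous_on ({0..} \<times> cbox 0 t) (\<lambda>(u, s). ge' (u - s) *\<^sub>R f s)"
      unfolding split_beta
      by (intro continuous_intros continuous_on_compose2[OF ge'_cont] continuous_on_compose2[OF f]) auto
  qed (use t in auto)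
  then have "((\<lambda>u. \<Phi> u t) has_derivative (\<lambda>d. d *\<^sub>R integral {0..t} (\<lambda>s. ge' (t - s) *\<^sub>R f s))) (at t within {0..})"
    by (simp add: \<Phi>_def[abs_def] has_vector_derivative_def)
  moreover have "integral {0..t} (\<lambda>s. ge' (t - s) *\<^sub>R f s) = convol g' f t"
    unfolding convol_def by (intro integral_cong) (auto simp: ge'_def max_def)
  ultimately have t': "((\<lambda>u. \<Phi> u t) has_derivative (\<lambda>d. d *\<^sub>R convol g' f t)) (at t within {0..})"
    by simp
  have "((\<lambda>(u, x). \<Phi> u x) has_derivative
      (\<lambda>(du, dx). du *\<^sub>R convol g' f t + blinfun_apply (blinfun_scaleR_left (ge (t - t) *\<^sub>R f t)) dx))
      (at (t, t) within {0..} \<times> {0..})"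
  proof (rule has_derivative_partialsI[OF t' x])
    have "continuous_on ({0..} \<times> {0..}) (\<lambda>(u, x). blinfun_scaleR_left (ge (u - x) *\<^sub>R f x))"
      unfolding split_beta
      by (intro bounded_linear.continuous_on[OF bounded_linear_blinfun_scaleR_left]
          continuous_intros continuous_on_compose2[OF ge_cont[of UNIV]] continuous_on_compose2[OF f]) auto
    then show "continuous (at (t, t) within {0..} \<times> {0..}) (\<lambda>(u, x). blinfun_scaleR_left (ge (u - x) *\<^sub>R f x))"
      using t by (auto simp: continuous_on_eq_continuous_within)
  qed (use t in auto)
  from has_derivative_subset[OF this]
  have "((\<lambda>(u, x). \<Phi> u x) has_derivative
      (\<lambda>(du, dx). du *\<^sub>R convol g' f t + dx *\<^sub>R g 0 *\<^sub>R f t)) (at (t, t) within (\<lambda>u. (u, u)) ` {0..})"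
    by (auto simp: ge_def split_beta image_subset_iff)
  moreover have "((\<lambda>u. (u, u)) has_derivative (\<lambda>d. (d, d))) (at t within {0..})"
    by (intro derivative_intros)
  ultimately have "((\<lambda>u. \<Phi> u u) has_derivative
      (\<lambda>d. d *\<^sub>R convol g' f t + d *\<^sub>R g 0 *\<^sub>R f t)) (at t within {0..})"
    using has_derivative_in_compose[of "\<lambda>u. (u, u)" "\<lambda>d. (d, d)" t "{0..}" "\<lambda>(u, x). \<Phi> u x"
        "\<lambda>(du, dx). du *\<^sub>R convol g' f t + dx *\<^sub>R g 0 *\<^sub>R f t"] by simp
  then have d: "((\<lambda>u. \<Phi> u u) has_vector_derivative g 0 *\<^sub>R f t + convol g' f t) (at t within {0..})"
    by (simp add: has_vector_derivative_def algebra_simps)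
  show ?thesis
  proof (rule has_vector_derivative_transform[OF _ _ d])
    show "convol g f s = \<Phi> s s" for s
      unfolding convol_def \<Phi>_def by (intro integral_cong) (auto simp: ge_def)
  qed (use t in auto)
qed

section \<open>From the weak equation to energy identities\<close>

lemma continuous_near_pos:
  fixes f :: "real \<Rightarrow> real"
  assumes "continuous_on {0..} f" "0 < a" "0 < f a"
  obtains d where "0 < d" "\<And>t. a < t \<Longrightarrow> t < a + d \<Longrightarrow> 0 < f t"
proof -
  have "(f \<longlongrightarrow> f a) (at a within {0..})"
    using assms by (auto simp: continuous_on_def)
  then have "(f \<longlongrightarrow> f a) (at_right a)"
    by (rule tendsto_within_subset) (use assms in auto)
  then have "eventually (\<lambda>t. 0 < f t) (at_right a)"
    using assms order_tendstoD by blast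
  then obtain b where "b > a" "\<forall>t>a. t < b \<longrightarrow> 0 < f t"
    using eventually_at_right[of a "a + 1"] by auto
  then show ?thesis using that[of "b - a"] by auto
qed

text \<open>The du Bois-Reymond lemma. The sum of \<open>f\<close> and a primitive of
  \<open>h\<close> has vanishing distributional derivative; testing with functions whose derivative
  is a bump near \<open>a\<close> minus the same bump near \<open>b\<close> forces equal values at
  \<open>a\<close> and \<open>b\<close>.\<close>

lemma distributional_derivative_imp_derivative:
  fixes f h :: "real \<Rightarrow> real"
  assumes f: "continuous_on {0..} f" and h: "continuous_on {0..} h"
    and weak: "\<And>\<phi>. test_function \<phi> \<Longrightarrow>
      - integral {0<..} (\<lambda>t. f t * deriv \<phi> t) + integral {0<..} (\<lambda>t. h t * \<phi> t) = 0"
    and t: "0 \<le> t"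
  shows "(f has_vector_derivative - h t) (at t within {0..})"
proof -
  define K where "K t = integral {0..t} h" for t
  have K: "(K has_vector_derivative h t) (at t within {0..})" if "0 \<le> t" for t
    unfolding K_def[abs_def] using integral_has_vector_derivative_atLeast[OF h that] .
  have K_cont: "continuous_on {0..} K"
    using K by (intro continuous_on_vector_derivative) auto
  define F where "F t = f t + K t" for t
  have F_cont: "continuous_on {0..} F"
    unfolding F_def by (intro continuous_intros f K_cont)
  have F_eq: "F a = F b" if ab: "0 < a" "a < b" for a b
  proof (rule ccontr)
    assume neq: "F a \<noteq> F b"
    define m where "m = (F a + F b) / 2"
    \<comment> \<open>The factor \<open>F a - F b\<close> settles the signs at once:
      \<open>q\<close> is positive at \<open>a\<close> and negative at \<open>b\<close>, whichever
      value of \<open>F\<close> is larger.\<close>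
    define q where "q t = (F a - F b) * (F t - m)" for t
    have q_cont: "continuous_on {0..} q"
      unfolding q_def by (intro continuous_intros F_cont)
    have "q a = (F a - F b)\<^sup>2 / 2" "- q b = (F a - F b)\<^sup>2 / 2"
      by (simp_all add: q_def m_def power2_eq_square field_simps)
    moreover have "0 < (F a - F b)\<^sup>2"
      using neq by simp
    ultimately have "0 < q a" "0 < - q b"
      by linarith+
    moreover have "continuous_on {0..} (\<lambda>t. - q t)"
      by (intro continuous_intros q_cont)
    moreover have "0 < b" using ab by simp
    ultimately obtain d1 d2
      where d: "0 < d1" "\<And>t. a < t \<Longrightarrow> t < a + d1 \<Longrightarrow> 0 < q t"
        "0 < d2" "\<And>t. b < t \<Longrightarrow> t < b + d2 \<Longrightarrow> 0 < - q t"
      using continuous_near_pos[OF q_cont ab(1)] continuous_near_pos[of "\<lambda>t. - q t" b] by metis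
    \<comment> \<open>At most \<open>b - a\<close>, so the two bumps do not overlap; at most
      \<open>d1\<close> and \<open>d2\<close>, so \<open>q\<close> keeps its sign on each of
      them.\<close>
    define e where "e = min d1 (min d2 (b - a))"
    have e: "0 < e" "e \<le> d1" "e \<le> d2" "e \<le> b - a"
      using d ab by (auto simp: e_def)
    define \<rho> where "\<rho> x = bump 0 x * bump 0 (e - x)" for x
    have \<rho>0: "\<rho> x = 0" if "x \<notin> {0<..<e}" for x
      using that by (auto simp: \<rho>_def bump_def)
    have \<rho>pos: "0 < \<rho> x" if "x \<in> {0<..<e}" for x
      using that by (auto simp: \<rho>_def bump_def)
    obtain \<phi> where \<phi>: "test_function \<phi>" "\<And>t. (\<phi> has_real_derivative \<rho> (t - a) - \<rho> (t - b)) (at t)"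
      "\<And>t. t \<notin> {a..b + e} \<Longrightarrow> \<phi> t = 0"
      using test_function_exists[OF e(1) ab(1) less_imp_le[OF ab(2)]] unfolding \<rho>_def by blast
    define \<phi>' where "\<phi>' t = \<rho> (t - a) - \<rho> (t - b)" for t
    have \<phi>_cont: "continuous_on S \<phi>" for S
      using \<phi>(2) DERIV_isCont continuous_at_imp_continuous_on by blast
    have deriv: "deriv \<phi> t = \<phi>' t" for t
      using DERIV_imp_deriv[OF \<phi>(2)] by (simp add: \<phi>'_def)
    have \<phi>'0: "\<phi>' t = 0" if "t \<notin> {a..b + e}" for t
      using that e ab by (auto simp: \<phi>'_def \<rho>0)
    have \<phi>v: "(\<phi> has_vector_derivative \<phi>' t) (at t within {0..})" for t
      using \<phi>(2)[of t] unfolding \<phi>'_def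
      by (simp add: has_real_derivative_iff_has_vector_derivative has_vector_derivative_at_within)
    have "Ck_on (Suc 0) UNIV \<phi>"
      using \<phi>(1) unfolding test_function_def by blast
    then have "continuous_on UNIV (derivative_on UNIV \<phi>)" by simp
    moreover have "derivative_on UNIV \<phi> = \<phi>'"
      using \<phi>(2) by (auto simp: derivative_on_def fun_eq_iff \<phi>'_def
          has_real_derivative_iff_has_vector_derivative vector_derivative_at)
    ultimately have \<phi>'_cont: "continuous_on S \<phi>'" for S
      using continuous_on_subset by blast
    define B where "B = b + e + 1"
    have B: "0 < B" "\<phi> 0 = 0" "\<phi> B = 0" "{a..b+e} \<subseteq> {0..B}" "{0..B} \<subseteq> {0..}"
      using ab e by (auto simp: B_def \<phi>(3))
    have cut: "integral {0<..} w = integral {0..B} w"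
      if "\<And>t. t \<notin> {a..b + e} \<Longrightarrow> w t = 0" "continuous_on {0..} w" for w :: "real \<Rightarrow> real"
    proof -
      have "(w has_integral integral {a..b+e} w) {a..b+e}"
        using ab by (intro integrable_integral integrable_continuous_interval continuous_on_subset[OF that(2)]) auto
      then have "(w has_integral integral {a..b+e} w) {0<..}" "(w has_integral integral {a..b+e} w) {0..B}"
        using that(1) ab e B by (auto intro: has_integral_on_superset)
      then show ?thesis by (metis integral_unique)
    qed
    have int: "w integrable_on {0..B}" if "continuous_on {0..} w" for w :: "real \<Rightarrow> real"
      using that B(5) by (intro integrable_continuous_interval) (rule continuous_on_subset)
    have parts: "((\<lambda>t. K t * \<phi>' t + h t * \<phi> t) has_integral K B * \<phi> B - K 0 * \<phi> 0) {0..B}"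
      by (rule ftc_atLeast) (use B(1) in \<open>auto intro!: has_vector_derivative_mult K \<phi>v\<close>)
    have "integral {0..B} (\<lambda>t. f t * \<phi>' t) = integral {0..B} (\<lambda>t. h t * \<phi> t)"
    proof -
      have "integral {0<..} (\<lambda>t. f t * \<phi>' t) = integral {0..B} (\<lambda>t. f t * \<phi>' t)"
        by (rule cut) (auto simp: \<phi>'0 intro!: continuous_intros f \<phi>'_cont)
      moreover have "integral {0<..} (\<lambda>t. h t * \<phi> t) = integral {0..B} (\<lambda>t. h t * \<phi> t)"
        by (rule cut) (auto simp: \<phi>(3) intro!: continuous_intros h \<phi>_cont)
      ultimately show ?thesis
        using weak[OF \<phi>(1)] by (simp add: deriv)
    qed
    then have F0: "integral {0..B} (\<lambda>t. F t * \<phi>' t) = 0"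
    proof -
      have "integral {0..B} (\<lambda>t. F t * \<phi>' t) =
          integral {0..B} (\<lambda>t. f t * \<phi>' t) + integral {0..B} (\<lambda>t. K t * \<phi>' t)"
        unfolding F_def distrib_right
        by (intro Henstock_Kurzweil_Integration.integral_add int continuous_intros f \<phi>'_cont K_cont)
      moreover have "integral {0..B} (\<lambda>t. K t * \<phi>' t) + integral {0..B} (\<lambda>t. h t * \<phi> t) = 0"
        using integral_unique[OF parts] B
        by (subst Henstock_Kurzweil_Integration.integral_add[symmetric])
          (auto intro!: int continuous_intros h \<phi>_cont \<phi>'_cont K_cont)
      ultimately show ?thesis
        using \<open>integral {0..B} (\<lambda>t. f t * \<phi>' t) = _\<close> by simp
    qed
    \<comment> \<open>Constants are annihilated as well, which permits replacing \<open>F\<close> by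
      \<open>F - m\<close>.\<close>
    have \<phi>'_int: "integral {0..B} \<phi>' = 0"
      using integral_unique[OF ftc_atLeast[of \<phi> \<phi>' 0 B]] \<phi>v B by simp
    have "integral {0..B} (\<lambda>t. q t * \<phi>' t) =
        integral {0..B} (\<lambda>t. (F a - F b) * (F t * \<phi>' t) - ((F a - F b) * m) * \<phi>' t)"
      by (rule integral_cong) (simp add: q_def algebra_simps)
    also have "\<dots> = integral {0..B} (\<lambda>t. (F a - F b) * (F t * \<phi>' t)) - integral {0..B} (\<lambda>t. ((F a - F b) * m) * \<phi>' t)"
      by (intro Henstock_Kurzweil_Integration.integral_diff int continuous_intros F_cont \<phi>'_cont)
    also have "\<dots> = 0"
      by (simp add: F0 \<phi>'_int)
    finally have q0: "integral {0..B} (\<lambda>t. q t * \<phi>' t) = 0" .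
    have q_nonneg: "0 \<le> q t * \<phi>' t" for t
    proof -
      consider "t - a \<in> {0<..<e}" "t - b \<notin> {0<..<e}" | "t - b \<in> {0<..<e}" "t - a \<notin> {0<..<e}"
        | "t - a \<notin> {0<..<e}" "t - b \<notin> {0<..<e}"
        using e ab by force
      then show ?thesis
      proof cases
        case 1
        then have "0 < q t" using d(2)[of t] e by auto
        then show ?thesis using 1 \<rho>pos[OF 1(1)] by (simp add: \<phi>'_def \<rho>0)
      next
        case 2
        then have "q t < 0" using d(4)[of t] e by auto
        then show ?thesis using 2 \<rho>pos[OF 2(1)] by (simp add: \<phi>'_def \<rho>0 mult_nonpos_nonneg)
      next
        case 3
        then show ?thesis by (simp add: \<phi>'_def \<rho>0)
      qed
    qed
    have "\<forall>t\<in>{0..B}. q t * \<phi>' t = 0"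
    proof (rule integral_eq_0_iff[THEN iffD1])
      show "continuous_on {0..B} (\<lambda>t. q t * \<phi>' t)"
        by (intro continuous_intros \<phi>'_cont continuous_on_subset[OF q_cont] B(5))
    qed (use q0 q_nonneg B in auto)
    moreover have "a + e / 2 \<in> {0..B}" "q (a + e / 2) > 0" "\<phi>' (a + e / 2) > 0"
      using ab e d(2)[of "a + e / 2"] \<rho>pos[of "e / 2"] by (auto simp: B_def \<phi>'_def \<rho>0)
    ultimately show False by force
  qed
  have F_const: "F t = F 1" if "0 \<le> t" for t
  proof (cases "t = 0")
    case True
    \<comment> \<open>The comparison of values needs positive times; the value at 0 is reached by
      continuity.\<close>
    have "(F \<longlongrightarrow> F 0) (at 0 within {0..})"
      using F_cont by (auto simp: continuous_on_def)
    then have "(F \<longlongrightarrow> F 0) (at_right 0)"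
      by (rule tendsto_within_subset) auto
    moreover have "(F \<longlongrightarrow> F 1) (at_right 0)"
    proof (rule tendsto_eventually)
      show "eventually (\<lambda>t. F t = F 1) (at_right 0)"
        using eventually_at_right_less by (rule eventually_mono) (metis F_eq linorder_cases zero_less_one)
    qed
    ultimately show ?thesis
      using True tendsto_unique trivial_limit_at_right_real by blast
  next
    case False
    then show ?thesis using that by (metis F_eq less_eq_real_def linorder_less_linear zero_less_one)
  qed
  have "((\<lambda>t. F 1 - K t) has_vector_derivative 0 - h t) (at t within {0..})"
    by (intro has_vector_derivative_diff has_vector_derivative_const K t)
  then have "((\<lambda>t. F 1 - K t) has_vector_derivative - h t) (at t within {0..})"
    by simp
  then show ?thesis
  proof (rule has_vector_derivative_transform[rotated 2])
    show "f s = F 1 - K s" if "s \<in> {0..}" for s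
      using F_const[of s] that by (simp add: F_def)
  qed (use t in auto)
qed

section \<open>Averaging the weak equation in time\<close>

lemma forward_mean_linear:
  fixes q :: "real \<Rightarrow> 'b::banach" and l :: "'b \<Rightarrow> 'c::banach"
  assumes "bounded_linear l" "continuous_on {0..} q" "0 \<le> t" "0 < h"
  shows "forward_mean (\<lambda>t. l (q t)) h t = l (forward_mean q h t)"
proof -
  have "continuous_on {0..1} (\<lambda>\<theta>. q (t + h * \<theta>))"
    using assms by (intro continuous_on_compose2[OF assms(2)] continuous_intros) auto
  then have "(\<lambda>\<theta>. q (t + h * \<theta>)) integrable_on {0..1}"
    by (rule integrable_continuous_interval)
  from integral_linear[OF this assms(1)] show ?thesis
    by (simp add: forward_mean_def o_def)
qed

lemma forward_mean_add:
  fixes p q :: "real \<Rightarrow> 'b::banach"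
  assumes "continuous_on {0..} p" "continuous_on {0..} q" "0 \<le> t" "0 < h"
  shows "forward_mean (\<lambda>t. p t + q t) h t = forward_mean p h t + forward_mean q h t"
proof -
  have "(\<lambda>\<theta>. f (t + h * \<theta>)) integrable_on {0..1}" if "continuous_on {0..} f" for f :: "real \<Rightarrow> 'b"
    using assms(3,4)
    by (intro integrable_continuous_interval continuous_on_compose2[OF that] continuous_intros) auto
  from this[OF assms(1)] this[OF assms(2)] show ?thesis
    unfolding forward_mean_def by (rule Henstock_Kurzweil_Integration.integral_add)
qed

lemma continuous_on_forward_mean_pair:
  fixes q :: "real \<Rightarrow> 'b::banach"
  shows "continuous_on {0..} q \<Longrightarrow>
    continuous_on ({0..} \<times> {0..}) (\<lambda>x. forward_mean q (fst x) (snd x))"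
  using continuous_on_forward_mean[of q] by (simp add: split_beta)

text \<open>The pair \<open>(v, V)\<close> is frozen while the equation is averaged. The result is a
  pointwise identity, into which admissible vectors depending on \<open>t\<close> and
  \<open>h\<close> may then be inserted.\<close>

lemma mean_weak_equation:
  fixes p F Q :: "real \<Rightarrow> 'b::{real_inner, banach}"
  assumes F: "continuous_on {0..} F" and Q: "continuous_on {0..} Q"
    and weak: "\<And>t. 0 \<le> t \<Longrightarrow>
      ((\<lambda>t. \<tau> * (p t \<bullet> v)) has_vector_derivative F t \<bullet> v - Q t \<bullet> V) (at t within {0..})"
    and t: "0 \<le> t" and h: "0 < h"
  shows "\<tau> * (((p (t + h) - p t) /\<^sub>R h) \<bullet> v) = forward_mean F h t \<bullet> v - forward_mean Q h t \<bullet> V"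
proof -
  have "\<tau> * (((p (t + h) - p t) /\<^sub>R h) \<bullet> v) = forward_mean (\<lambda>t. F t \<bullet> v + Q t \<bullet> (- V)) h t"
    by (subst forward_mean_derivative[OF _ t h, of "\<lambda>t. \<tau> * (p t \<bullet> v)"])
      (use weak in \<open>auto simp: algebra_simps inner_diff_left\<close>)
  also have "\<dots> = forward_mean (\<lambda>t. F t \<bullet> v) h t + forward_mean (\<lambda>t. Q t \<bullet> (- V)) h t"
    by (intro forward_mean_add continuous_intros F Q t h)
  also have "\<dots> = forward_mean F h t \<bullet> v + forward_mean Q h t \<bullet> (- V)"
    by (simp only: forward_mean_linear[OF bounded_linear_inner_left F t h]
        forward_mean_linear[OF bounded_linear_inner_left Q t h])
  finally show ?thesis by simp
qed

text \<open>The trajectory \<open>p\<close> is only weakly differentiable, so the two product rules below are obtained for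
  its forward means, which are differentiable and admissible as test vectors, and passed to the limit.\<close>

lemma weak_product_rule:
  fixes p F Q v v' V :: "real \<Rightarrow> 'b::{real_inner, banach}"
  assumes p: "continuous_on {0..} p" and F: "continuous_on {0..} F" and Q: "continuous_on {0..} Q"
    and weak: "\<And>x X t. (x, X) \<in> D \<Longrightarrow> 0 \<le> t \<Longrightarrow>
      ((\<lambda>t. \<tau> * (p t \<bullet> x)) has_vector_derivative F t \<bullet> x - Q t \<bullet> X) (at t within {0..})"
    and D: "\<And>t. 0 \<le> t \<Longrightarrow> (v t, V t) \<in> D"
    and v: "\<And>t. 0 \<le> t \<Longrightarrow> (v has_vector_derivative v' t) (at t within {0..})"
    and v': "continuous_on {0..} v'" and V: "continuous_on {0..} V" and t: "0 \<le> t"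
  shows "((\<lambda>t. \<tau> * (p t \<bullet> v t)) has_vector_derivative
    F t \<bullet> v t - Q t \<bullet> V t + \<tau> * (p t \<bullet> v' t)) (at t within {0..})"
proof -
  have v_cont: "continuous_on {0..} v"
    using v by (intro continuous_on_vector_derivative) auto
  have snd_cont: "continuous_on ({0..} \<times> {0..}) (\<lambda>x. f (snd x))" if "continuous_on {0..} f"
    for f :: "real \<Rightarrow> 'b"
    by (intro continuous_on_compose2[OF that] continuous_intros) auto
  have "((\<lambda>t. \<tau> * (forward_mean p 0 t \<bullet> v t)) has_vector_derivative
    forward_mean F 0 t \<bullet> v t - forward_mean Q 0 t \<bullet> V t + \<tau> * (forward_mean p 0 t \<bullet> v' t)) (at t within {0..})"
  proof (rule derivative_limit[OF _ _ _ t])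
    fix h t :: real
    assume h: "0 < h" and t: "0 \<le> t"
    have "((\<lambda>t. \<tau> * (forward_mean p h t \<bullet> v t)) has_vector_derivative
        \<tau> * (forward_mean p h t \<bullet> v' t + ((p (t + h) - p t) /\<^sub>R h) \<bullet> v t)) (at t within {0..})"
      by (intro bounded_linear.has_vector_derivative[OF bounded_linear_mult_right]
          bounded_bilinear.has_vector_derivative[OF bounded_bilinear_inner]
          forward_mean_has_vector_derivative p t h v)
    then show "((\<lambda>t. \<tau> * (forward_mean p h t \<bullet> v t)) has_vector_derivative
        forward_mean F h t \<bullet> v t - forward_mean Q h t \<bullet> V t + \<tau> * (forward_mean p h t \<bullet> v' t)) (at t within {0..})"
      using mean_weak_equation[OF F Q weak[OF D] t h, of t] t by (simp add: distrib_left add.commute)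
  next
    show "continuous_on ({0..} \<times> {0..}) (\<lambda>(h, t). \<tau> * (forward_mean p h t \<bullet> v t))"
      "continuous_on ({0..} \<times> {0..}) (\<lambda>(h, t).
        forward_mean F h t \<bullet> v t - forward_mean Q h t \<bullet> V t + \<tau> * (forward_mean p h t \<bullet> v' t))"
      unfolding split_beta
      by (intro continuous_intros continuous_on_forward_mean_pair snd_cont p F Q v_cont v' V)+
  qed
  then show ?thesis by simp
qed

lemma weak_energy_identity:
  fixes p F w W r r' :: "real \<Rightarrow> 'b::{real_inner, banach}"
  assumes p: "continuous_on {0..} p" and F: "continuous_on {0..} F" and W: "continuous_on {0..} W"
    and r': "continuous_on {0..} r'"
    and weak: "\<And>x X t. (x, X) \<in> D \<Longrightarrow> 0 \<le> t \<Longrightarrow>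
      ((\<lambda>t. \<tau> * (p t \<bullet> x)) has_vector_derivative F t \<bullet> x - (\<beta> *\<^sub>R W t + r t) \<bullet> X) (at t within {0..})"
    and D: "subspace D" "\<And>t. 0 \<le> t \<Longrightarrow> (w t, W t) \<in> D"
    and w: "\<And>t. 0 \<le> t \<Longrightarrow> (w has_vector_derivative p t) (at t within {0..})"
    and r: "\<And>t. 0 \<le> t \<Longrightarrow> (r has_vector_derivative r' t) (at t within {0..})"
    and t: "0 \<le> t"
  shows "((\<lambda>t. \<tau> / 2 * (p t \<bullet> p t) + \<beta> / 2 * (W t \<bullet> W t) + r t \<bullet> W t) has_vector_derivative
    F t \<bullet> p t + r' t \<bullet> W t) (at t within {0..})"
proof -
  let ?m = "forward_mean"
  have r_cont: "continuous_on {0..} r"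
    using r by (intro continuous_on_vector_derivative) auto
  have "((\<lambda>t. \<tau> / 2 * (?m p 0 t \<bullet> ?m p 0 t) + \<beta> / 2 * (?m W 0 t \<bullet> ?m W 0 t) + ?m r 0 t \<bullet> ?m W 0 t)
    has_vector_derivative ?m F 0 t \<bullet> ?m p 0 t + ?m r' 0 t \<bullet> ?m W 0 t) (at t within {0..})"
  proof (rule derivative_limit[OF _ _ _ t])
    fix h t :: real
    assume h: "0 < h" and t: "0 \<le> t"
    define P' where "P' = (p (t + h) - p t) /\<^sub>R h"
    define W' where "W' = (W (t + h) - W t) /\<^sub>R h"
    have r'_mean: "(r (t + h) - r t) /\<^sub>R h = ?m r' h t"
      by (rule forward_mean_derivative[OF r t h, symmetric])
    \<comment> \<open>\<open>p\<close> itself need not be admissible, but its mean is the difference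
      quotient of \<open>w\<close>, and \<open>D\<close> is a subspace.\<close>
    have "((w (t + h), W (t + h)) - (w t, W t)) /\<^sub>R h \<in> D"
      using t h by (intro subspace_scale subspace_diff D) auto
    then have mem: "(?m p h t, W') \<in> D"
      using forward_mean_derivative[OF w t h] by (simp add: W'_def)
    have "?m (\<lambda>t. \<beta> *\<^sub>R W t + r t) h t = ?m (\<lambda>t. \<beta> *\<^sub>R W t) h t + ?m r h t"
      by (intro forward_mean_add continuous_intros W r_cont t h)
    then have Q: "?m (\<lambda>t. \<beta> *\<^sub>R W t + r t) h t = \<beta> *\<^sub>R ?m W h t + ?m r h t"
      by (simp add: forward_mean_linear[OF bounded_linear_scaleR_right W t h])
    have eq: "\<tau> * (P' \<bullet> ?m p h t) = ?m F h t \<bullet> ?m p h t - (\<beta> *\<^sub>R ?m W h t + ?m r h t) \<bullet> W'"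
      unfolding P'_def Q[symmetric]
      by (rule mean_weak_equation[OF F _ weak[OF mem] t h]) (intro continuous_intros W r_cont)
    have dP: "(?m p h has_vector_derivative P') (at t within {0..})"
      unfolding P'_def by (rule forward_mean_has_vector_derivative[OF p t h])
    have dW: "(?m W h has_vector_derivative W') (at t within {0..})"
      unfolding W'_def by (rule forward_mean_has_vector_derivative[OF W t h])
    have dr: "(?m r h has_vector_derivative ?m r' h t) (at t within {0..})"
      using forward_mean_has_vector_derivative[OF r_cont t h] unfolding r'_mean .
    have "((\<lambda>t. \<tau> / 2 * (?m p h t \<bullet> ?m p h t) + \<beta> / 2 * (?m W h t \<bullet> ?m W h t) + ?m r h t \<bullet> ?m W h t)
      has_vector_derivative \<tau> / 2 * (?m p h t \<bullet> P' + P' \<bullet> ?m p h t) + \<beta> / 2 * (?m W h t \<bullet> W' + W' \<bullet> ?m W h t)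
        + (?m r h t \<bullet> W' + ?m r' h t \<bullet> ?m W h t)) (at t within {0..})"
      by (intro has_vector_derivative_add bounded_linear.has_vector_derivative[OF bounded_linear_mult_right]
          bounded_bilinear.has_vector_derivative[OF bounded_bilinear_inner] dP dW dr)
    \<comment> \<open>All pairings with \<open>W'\<close>, which need not converge as
      \<open>h\<close> tends to 0, cancel against those of the averaged equation.\<close>
    then show "((\<lambda>t. \<tau> / 2 * (?m p h t \<bullet> ?m p h t) + \<beta> / 2 * (?m W h t \<bullet> ?m W h t) + ?m r h t \<bullet> ?m W h t)
      has_vector_derivative ?m F h t \<bullet> ?m p h t + ?m r' h t \<bullet> ?m W h t) (at t within {0..})"
      using eq by (elim has_vector_derivative_eq_rhs) (simp add: inner_commute inner_add_left algebra_simps)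
  next
    show "continuous_on ({0..} \<times> {0..}) (\<lambda>(h, t).
        \<tau> / 2 * (?m p h t \<bullet> ?m p h t) + \<beta> / 2 * (?m W h t \<bullet> ?m W h t) + ?m r h t \<bullet> ?m W h t)"
      "continuous_on ({0..} \<times> {0..}) (\<lambda>(h, t). ?m F h t \<bullet> ?m p h t + ?m r' h t \<bullet> ?m W h t)"
      unfolding split_beta
      by (intro continuous_intros continuous_on_forward_mean_pair p F W r' r_cont)+
  qed
  then show ?thesis by simp
qed

section \<open>Energy and Lyapunov function\<close>

lemma inner_le_weighted:
  fixes x y :: "'b::real_inner"
  assumes "0 < e"
  shows "2 * (x \<bullet> y) \<le> e * (x \<bullet> x) + (y \<bullet> y) / e"
proof -
  have "0 \<le> (e *\<^sub>R x - y) \<bullet> (e *\<^sub>R x - y)" by simp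
  also have "\<dots> = e * (e * (x \<bullet> x) - 2 * (x \<bullet> y) + (y \<bullet> y) / e)"
    using assms by (simp add: inner_diff_left inner_diff_right inner_commute[of y x] algebra_simps)
  finally show ?thesis
    using assms by (simp add: zero_le_mult_iff)
qed

lemma inner_ge_weighted:
  fixes x y :: "'b::real_inner"
  assumes "0 < e"
  shows "- (e * (x \<bullet> x) + (y \<bullet> y) / e) \<le> 2 * (x \<bullet> y)"
  using inner_le_weighted[OF assms, of "- x" y] by simp

section \<open>Memory integrals\<close>

lemma integral_reversed_derivative:
  fixes Q :: "real \<Rightarrow> real"
  assumes Q: "\<And>t. 0 \<le> t \<Longrightarrow> (Q has_vector_derivative q t) (at t within {0..})" and t: "0 \<le> t"
  shows "((\<lambda>s. q (t - s)) has_integral Q t - Q 0) {0..t}"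
proof -
  have "((\<lambda>s. - (Q \<circ> (\<lambda>s. t - s)) s) has_vector_derivative - (- 1 *\<^sub>R q (t - s))) (at s within {0..t})"
    if "s \<in> {0..t}" for s
  proof (intro has_vector_derivative_minus vector_diff_chain_within)
    show "((\<lambda>s. t - s) has_vector_derivative - 1) (at s within {0..t})"
      by (auto intro!: derivative_eq_intros)
    show "(Q has_vector_derivative q (t - s)) (at (t - s) within (\<lambda>s. t - s) ` {0..t})"
      using that by (intro has_vector_derivative_within_subset[OF Q]) auto
  qed
  from fundamental_theorem_of_calculus[OF t this] show ?thesis by simp
qed

context
  fixes q :: "real \<Rightarrow> real" and f :: "real \<Rightarrow> 'b::{real_inner, banach}" and t :: real
  assumes q: "continuous_on {0..} q" and f: "continuous_on {0..} f"
begin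

lemma continuous_on_memory [continuous_intros]:
  "continuous_on {0..t} (\<lambda>s. q (t - s))" "continuous_on {0..t} f"
  by (auto intro!: continuous_on_compose2[OF q] continuous_intros continuous_on_subset[OF f])

lemma memory_cross_eq:
  "integral {0..t} (\<lambda>s. q (t - s) * ((f t - f s) \<bullet> x)) =
    integral {0..t} (\<lambda>s. q (t - s)) * (f t \<bullet> x) - convol q f t \<bullet> x"
proof -
  have "((\<lambda>s. q (t - s) *\<^sub>R f s) has_integral convol q f t) {0..t}"
    unfolding convol_def by (intro integrable_integral convol_integrable q f)
  from has_integral_linear[OF this bounded_linear_inner_left[of x]]
  have "((\<lambda>s. q (t - s) * (f s \<bullet> x)) has_integral convol q f t \<bullet> x) {0..t}"
    by (simp add: o_def)
  moreover have "((\<lambda>s. q (t - s) * (f t \<bullet> x)) has_integral integral {0..t} (\<lambda>s. q (t - s)) * (f t \<bullet> x)) {0..t}"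
    by (intro has_integral_mult_left integrable_integral integrable_continuous_interval continuous_on_memory)
  ultimately show ?thesis
    by (auto dest: has_integral_diff intro!: integral_unique simp: inner_diff_left right_diff_distrib)
qed

text \<open>Expanding the square reduces the memory term to convolutions with \<open>f\<close> and
  with its squared norm, which the Leibniz rule can differentiate.\<close>

lemma memory_circ_eq:
  "memory_circ q f t = integral {0..t} (\<lambda>s. q (t - s)) * (f t \<bullet> f t) - 2 * (convol q f t \<bullet> f t)
    + convol q (\<lambda>s. f s \<bullet> f s) t"
proof -
  have "memory_circ q f t = integral {0..t}
      (\<lambda>s. 2 * (q (t - s) * ((f t - f s) \<bullet> f t)) - (q (t - s) * (f t \<bullet> f t) - q (t - s) *\<^sub>R (f s \<bullet> f s)))"
    unfolding memory_circ_def
    by (intro integral_cong)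
      (simp add: power2_norm_eq_inner inner_diff_left inner_diff_right inner_commute algebra_simps)
  also have "\<dots> = 2 * integral {0..t} (\<lambda>s. q (t - s) * ((f t - f s) \<bullet> f t))
      - (integral {0..t} (\<lambda>s. q (t - s) * (f t \<bullet> f t)) - integral {0..t} (\<lambda>s. q (t - s) *\<^sub>R (f s \<bullet> f s)))"
    by (simp add: Henstock_Kurzweil_Integration.integral_diff integrable_continuous_interval continuous_intros)
  also have "\<dots> = 2 * integral {0..t} (\<lambda>s. q (t - s) * ((f t - f s) \<bullet> f t))
      - integral {0..t} (\<lambda>s. q (t - s)) * (f t \<bullet> f t) + convol q (\<lambda>s. f s \<bullet> f s) t"
    by (simp add: convol_def)
  finally show ?thesis
    unfolding memory_cross_eq by simp
qed

text \<open>Young's inequality under the integral, with the kernel as weight. The kernel is an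
  arbitrary nonnegative one because such estimates are needed for both \<open>g\<close> and
  \<open>- g'\<close>.\<close>

lemma memory_cross_le:
  assumes pos: "\<And>r. 0 \<le> r \<Longrightarrow> 0 \<le> q r" and e: "0 < e"
  shows "2 * integral {0..t} (\<lambda>s. q (t - s) * ((f t - f s) \<bullet> x)) \<le>
    e * memory_circ q f t + integral {0..t} (\<lambda>s. q (t - s)) * (x \<bullet> x) / e"
proof -
  have "2 * integral {0..t} (\<lambda>s. q (t - s) * ((f t - f s) \<bullet> x)) =
      integral {0..t} (\<lambda>s. 2 * (q (t - s) * ((f t - f s) \<bullet> x)))" by simp
  also have "\<dots> \<le> integral {0..t} (\<lambda>s. e * (q (t - s) * (norm (f t - f s))\<^sup>2) + q (t - s) * (x \<bullet> x / e))"
  proof (rule integral_le)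
    fix s assume s: "s \<in> {0..t}"
    have "q (t - s) * (2 * ((f t - f s) \<bullet> x)) \<le> q (t - s) * (e * ((f t - f s) \<bullet> (f t - f s)) + (x \<bullet> x) / e)"
      using s by (intro mult_left_mono inner_le_weighted e pos) auto
    then show "2 * (q (t - s) * ((f t - f s) \<bullet> x)) \<le> e * (q (t - s) * (norm (f t - f s))\<^sup>2) + q (t - s) * (x \<bullet> x / e)"
      by (simp add: power2_norm_eq_inner distrib_left mult_ac)
  qed (intro integrable_continuous_interval continuous_intros)+
  also have "\<dots> = e * memory_circ q f t + integral {0..t} (\<lambda>s. q (t - s)) * (x \<bullet> x) / e"
    unfolding memory_circ_def
    using e by (subst Henstock_Kurzweil_Integration.integral_add)
      (auto intro!: integrable_continuous_interval continuous_intros)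
  finally show ?thesis .
qed

end

lemma memory_cross_ge:
  fixes q :: "real \<Rightarrow> real" and f :: "real \<Rightarrow> 'b::{real_inner, banach}"
  assumes "continuous_on {0..} q" "continuous_on {0..} f" "\<And>r. 0 \<le> r \<Longrightarrow> 0 \<le> q r" "0 < e"
  shows "- (e * memory_circ q f t + integral {0..t} (\<lambda>s. q (t - s)) * (x \<bullet> x) / e) \<le>
    2 * integral {0..t} (\<lambda>s. q (t - s) * ((f t - f s) \<bullet> x))"
  using memory_cross_le[OF assms, of t "- x"] by simp

text \<open>The pairs \<open>(v, V) \<in> D\<close> stand for \<open>V = \<A>\<^sup>1\<^sup>/\<^sup>2 v\<close>, so \<open>U\<close> and \<open>U1\<close> are the images of \<open>u\<close> and \<open>u\<^sub>t\<close> under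
  \<open>\<A>\<^sup>1\<^sup>/\<^sup>2\<close>.\<close>

locale mgt_trajectory =
  fixes \<tau> \<alpha> b c k \<sigma> lam Ginf :: real and g g' :: "real \<Rightarrow> real"
    and D :: "('b::{real_inner, banach} \<times> 'b) set" and u u1 u2 U U1 :: "real \<Rightarrow> 'b"
  assumes pos: "0 < \<tau>" "0 < \<alpha>" "0 < b" "0 < lam" "0 < \<sigma>" "\<sigma> < k"
    and k: "c\<^sup>2 < b * k" "\<tau> * k < \<alpha>" and g0: "g 0 < (k - \<sigma>) * (b * k - c\<^sup>2)"
    and g: "\<And>t. 0 \<le> t \<Longrightarrow> (g has_vector_derivative g' t) (at t within {0..})"
    and g': "continuous_on {0..} g'"
    and g_pos: "\<And>t. 0 \<le> t \<Longrightarrow> 0 < g t" and g'_le: "\<And>t. 0 \<le> t \<Longrightarrow> g' t \<le> 0"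
    and G_le: "\<And>t. 0 \<le> t \<Longrightarrow> memory_integral g t \<le> Ginf" and Ginf: "0 < Ginf" "Ginf < c\<^sup>2"
    and D: "subspace D" "\<And>t. 0 \<le> t \<Longrightarrow> (u t, U t) \<in> D" "\<And>t. 0 \<le> t \<Longrightarrow> (u1 t, U1 t) \<in> D"
    and poincare: "\<And>v V. (v, V) \<in> D \<Longrightarrow> norm v \<le> lam * norm V"
    and u: "\<And>t. 0 \<le> t \<Longrightarrow> (u has_vector_derivative u1 t) (at t within {0..})"
    and u1: "\<And>t. 0 \<le> t \<Longrightarrow> (u1 has_vector_derivative u2 t) (at t within {0..})"
    and u2: "continuous_on {0..} u2"
    and U: "\<And>t. 0 \<le> t \<Longrightarrow> (U has_vector_derivative U1 t) (at t within {0..})"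
    and U1: "continuous_on {0..} U1"
    and weak: "\<And>v V t. (v, V) \<in> D \<Longrightarrow> 0 \<le> t \<Longrightarrow>
      ((\<lambda>t. \<tau> * (u2 t \<bullet> v)) has_vector_derivative
        (- \<alpha> *\<^sub>R u2 t) \<bullet> v - (c\<^sup>2 *\<^sub>R U t + b *\<^sub>R U1 t - convol g U t) \<bullet> V) (at t within {0..})"
begin

definition E :: "real \<Rightarrow> real" where
  "E t = b * (norm (U1 t))\<^sup>2 + 2 * c\<^sup>2 * (U t \<bullet> U1 t) + c\<^sup>2 * k * (norm (U t))\<^sup>2
     + \<tau> * (norm (u2 t + k *\<^sub>R u1 t))\<^sup>2 + k * \<tau> * (\<alpha> / \<tau> - k) * (norm (u1 t))\<^sup>2
     + k * memory_circ g U t - k * memory_integral g t * (norm (U t))\<^sup>2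
     + 2 * integral {0..t} (\<lambda>s. g (t - s) * ((U t - U s) \<bullet> U1 t))
     - 2 * memory_integral g t * (U t \<bullet> U1 t)"

abbreviation G :: "real \<Rightarrow> real" where "G \<equiv> memory_integral g"

definition M :: "real \<Rightarrow> real" where "M t = memory_circ g U t"

text \<open>Not the derivative of \<open>M\<close>: it is the memory term with kernel
  \<open>- g'\<close>, the part of the past that the energy dissipates.\<close>

definition M' :: "real \<Rightarrow> real" where "M' t = memory_circ (\<lambda>r. - g' r) U t"

definition E' :: "real \<Rightarrow> real" where
  "E' t = - 2 * (\<alpha> - \<tau> * k) * (u2 t \<bullet> u2 t) - 2 * (b * k - c\<^sup>2) * (U1 t \<bullet> U1 t) - k * M' t
    - k * g t * (U t \<bullet> U t) - 2 * g t * (U t \<bullet> U1 t)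
    - 2 * integral {0..t} (\<lambda>s. - g' (t - s) * ((U t - U s) \<bullet> U1 t))"

text \<open>Besides \<open>M'\<close>, all of the energy loss that is kept. The square of
  \<open>U\<close> is absent, which is why the multiplier \<open>u\<close> is required
  later.\<close>

definition dissipated :: "real \<Rightarrow> real" where "dissipated t = u2 t \<bullet> u2 t + U1 t \<bullet> U1 t"

lemma g_cont: "continuous_on {0..} g"
  using g by (intro continuous_on_vector_derivative) auto

lemma u1_cont: "continuous_on {0..} u1"
  using u1 by (intro continuous_on_vector_derivative) auto

lemma U_cont: "continuous_on {0..} U"
  using U by (intro continuous_on_vector_derivative) auto

lemma G: "0 \<le> t \<Longrightarrow> (G has_vector_derivative g t) (at t within {0..})"
  unfolding memory_integral_def by (rule integral_has_vector_derivative_atLeast[OF g_cont])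

lemma G_nonneg: "0 \<le> G t"
  unfolding memory_integral_def
  using g_pos by (intro integral_nonneg integrable_continuous_interval continuous_on_subset[OF g_cont])
    (auto intro: less_imp_le)

lemma integral_g: "0 \<le> t \<Longrightarrow> integral {0..t} (\<lambda>s. g (t - s)) = G t"
  using integral_unique[OF integral_reversed_derivative[of G g, OF G]] by (simp add: memory_integral_def)

lemma integral_g': "0 \<le> t \<Longrightarrow> integral {0..t} (\<lambda>s. g' (t - s)) = g t - g 0"
  using integral_unique[OF integral_reversed_derivative[of g g', OF g]] by simp

lemma norm_u_le: "0 \<le> t \<Longrightarrow> u t \<bullet> u t \<le> lam\<^sup>2 * (U t \<bullet> U t)"
  using power_mono[OF poincare[OF D(2)], of t 2]
  by (simp add: power_mult_distrib flip: power2_norm_eq_inner)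

lemma norm_u1_le: "0 \<le> t \<Longrightarrow> u1 t \<bullet> u1 t \<le> lam\<^sup>2 * (U1 t \<bullet> U1 t)"
  using power_mono[OF poincare[OF D(3)], of t 2]
  by (simp add: power_mult_distrib flip: power2_norm_eq_inner)

lemma M_nonneg: "0 \<le> M t"
  unfolding M_def memory_circ_def using g_pos
  by (intro integral_nonneg integrable_continuous_interval continuous_intros g_cont U_cont)
    (auto intro!: mult_nonneg_nonneg intro: less_imp_le)

text \<open>With \<open>p = u2 + k u1\<close> and \<open>W = U1 + k U\<close>, whatever the stress
  contains beyond \<open>b W\<close>, the memory included, is collected in \<open>r\<close>, which
  is differentiable in norm; so \<open>weak_energy_identity\<close> applies. The rest of
  \<open>E\<close> is classically differentiable.\<close>

lemma E:
  assumes t: "0 \<le> t"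
  shows "(E has_vector_derivative E' t) (at t within {0..})"
proof -
  define p where "p t = u2 t + k *\<^sub>R u1 t" for t
  define w where "w t = u1 t + k *\<^sub>R u t" for t
  define W where "W t = U1 t + k *\<^sub>R U t" for t
  define F where "F t = - (\<alpha> - \<tau> * k) *\<^sub>R u2 t" for t
  define R where "R = convol g U"
  define R' where "R' t = g 0 *\<^sub>R U t + convol g' U t" for t
  define r where "r t = (c\<^sup>2 - b * k) *\<^sub>R U t - R t" for t
  define r' where "r' t = (c\<^sup>2 - b * k) *\<^sub>R U1 t - R' t" for t
  define N where "N t = U t \<bullet> U t" for t
  have N_cont: "continuous_on {0..} N"
    unfolding N_def by (intro continuous_intros U_cont)
  have R: "(R has_vector_derivative R' t) (at t within {0..})" if "0 \<le> t" for t
    unfolding R_def R'_def by (rule convol_has_vector_derivative[OF g g' U_cont that])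
  have scale: "((\<lambda>t. a *\<^sub>R f t) has_vector_derivative a *\<^sub>R d) (at t within {0..})"
    if "(f has_vector_derivative d) (at t within {0..})" for a d t and f :: "real \<Rightarrow> 'b"
    by (rule bounded_linear.has_vector_derivative[OF bounded_linear_scaleR_right that])
  have e: "((\<lambda>t. \<tau> / 2 * (p t \<bullet> p t) + b / 2 * (W t \<bullet> W t) + r t \<bullet> W t) has_vector_derivative
      F t \<bullet> p t + r' t \<bullet> W t) (at t within {0..})"
  proof (rule weak_energy_identity[where D = D and w = w])
    show "continuous_on {0..} p" "continuous_on {0..} F" "continuous_on {0..} W" "continuous_on {0..} r'"
      unfolding p_def F_def W_def r'_def R'_def
      by (intro continuous_intros u1_cont u2 U1 U_cont continuous_on_convol g')+
    show "(w t, W t) \<in> D" if "0 \<le> t" for t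
    proof -
      have "(u1 t, U1 t) + k *\<^sub>R (u t, U t) \<in> D"
        using that by (intro subspace_add subspace_scale D)
      then show ?thesis by (simp add: w_def W_def)
    qed
    show "(w has_vector_derivative p t) (at t within {0..})" if "0 \<le> t" for t
      unfolding w_def[abs_def] p_def by (intro has_vector_derivative_add scale u u1 that)
    show "(r has_vector_derivative r' t) (at t within {0..})" if "0 \<le> t" for t
      unfolding r_def[abs_def] r'_def by (intro has_vector_derivative_diff scale U R that)
    show "((\<lambda>t. \<tau> * (p t \<bullet> v)) has_vector_derivative F t \<bullet> v - (b *\<^sub>R W t + r t) \<bullet> V) (at t within {0..})"
      if "(v, V) \<in> D" "0 \<le> t" for v V t
    proof -
      have "((\<lambda>t. \<tau> * (u2 t \<bullet> v) + (\<tau> * k) * (u1 t \<bullet> v)) has_vector_derivative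
          ((- \<alpha> *\<^sub>R u2 t) \<bullet> v - (c\<^sup>2 *\<^sub>R U t + b *\<^sub>R U1 t - convol g U t) \<bullet> V) + (\<tau> * k) * (u2 t \<bullet> v)) (at t within {0..})"
        by (intro has_vector_derivative_add weak that
            bounded_linear.has_vector_derivative[OF bounded_linear_mult_right]
            bounded_linear.has_vector_derivative[OF bounded_linear_inner_left] u1)
      then show ?thesis
        by (simp add: p_def F_def W_def r_def R_def algebra_simps inner_add_left inner_diff_left)
    qed
  qed (use t D in auto)
  \<comment> \<open>The corrections restore \<open>E\<close>:
    \<open>b W \<bullet> W + 2 r \<bullet> W\<close> contains the square of \<open>U\<close> with
    the factor \<open>2 k c\<^sup>2 - b k\<^sup>2\<close> instead of \<open>k c\<^sup>2\<close>, and
    it lacks the convolution of \<open>g\<close> with that square.\<close>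
  have "((\<lambda>t. 2 * (\<tau> / 2 * (p t \<bullet> p t) + b / 2 * (W t \<bullet> W t) + r t \<bullet> W t)
      + (k * (b * k - c\<^sup>2)) * (U t \<bullet> U t) + (k * (\<alpha> - \<tau> * k)) * (u1 t \<bullet> u1 t) + k * convol g N t)
    has_vector_derivative
      2 * (F t \<bullet> p t + r' t \<bullet> W t) + (k * (b * k - c\<^sup>2)) * (U t \<bullet> U1 t + U1 t \<bullet> U t)
      + (k * (\<alpha> - \<tau> * k)) * (u1 t \<bullet> u2 t + u2 t \<bullet> u1 t) + k * (g 0 *\<^sub>R N t + convol g' N t)) (at t within {0..})"
    by (intro has_vector_derivative_add bounded_linear.has_vector_derivative[OF bounded_linear_mult_right] e
        bounded_bilinear.has_vector_derivative[OF bounded_bilinear_inner] U u1 t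
        convol_has_vector_derivative[OF g g' N_cont t])
  then have "(E has_vector_derivative
      2 * (F t \<bullet> p t + r' t \<bullet> W t) + (k * (b * k - c\<^sup>2)) * (U t \<bullet> U1 t + U1 t \<bullet> U t)
      + (k * (\<alpha> - \<tau> * k)) * (u1 t \<bullet> u2 t + u2 t \<bullet> u1 t) + k * (g 0 *\<^sub>R N t + convol g' N t)) (at t within {0..})"
  proof (rule has_vector_derivative_transform[rotated 2])
    fix s :: real assume "s \<in> {0..}"
    then have s: "0 \<le> s" by simp
    have "k * \<tau> * (\<alpha> / \<tau> - k) = k * (\<alpha> - \<tau> * k)"
      using pos by (simp add: field_simps)
    then show "E s = 2 * (\<tau> / 2 * (p s \<bullet> p s) + b / 2 * (W s \<bullet> W s) + r s \<bullet> W s)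
        + (k * (b * k - c\<^sup>2)) * (U s \<bullet> U s) + (k * (\<alpha> - \<tau> * k)) * (u1 s \<bullet> u1 s) + k * convol g N s"
      unfolding E_def memory_circ_eq[OF g_cont U_cont] memory_cross_eq[OF g_cont U_cont] integral_g[OF s]
        power2_norm_eq_inner p_def[symmetric]
      by (simp add: W_def r_def R_def N_def[abs_def] inner_add_left inner_add_right inner_diff_left
          inner_commute[of "U1 s" "U s"] algebra_simps power2_eq_square)
  qed (use t in auto)
  moreover have circ: "memory_circ (\<lambda>r. - g' r) U t = - memory_circ g' U t"
    by (simp add: memory_circ_def)
  ultimately show ?thesis
    unfolding E'_def M'_def circ memory_circ_eq[OF g' U_cont] mult_minus_left integral_neg
      memory_cross_eq[OF g' U_cont] integral_g'[OF t]
    by (elim has_vector_derivative_eq_rhs)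
      (simp add: p_def W_def F_def r'_def R'_def N_def[abs_def] inner_add_left inner_add_right inner_diff_left
          inner_commute[of "U1 t" "U t"] inner_commute[of "u1 t" "u2 t"] algebra_simps)
qed

lemma M'_nonneg: "0 \<le> M' t"
  unfolding M'_def memory_circ_def using g'_le
  by (intro integral_nonneg integrable_continuous_interval continuous_intros g' U_cont)
    (auto intro!: mult_nonpos_nonneg)

lemma dissipated_nonneg: "0 \<le> dissipated t"
  by (simp add: dissipated_def)

lemma G_lt: "0 \<le> t \<Longrightarrow> G t < c\<^sup>2"
  using G_le Ginf by fastforce

lemma k_pos: "0 < k"
  using pos by simp

text \<open>Both cross terms are split by Young's inequality with the same weight
  \<open>\<kappa> = k - \<sigma>\<close>. The costs \<open>(g 0 - g t) / \<kappa>\<close> and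
  \<open>g t / \<kappa>\<close> add up to \<open>g 0 / \<kappa>\<close>, which the choice of
  \<open>\<sigma>\<close> puts below \<open>b k - c\<^sup>2\<close>; the share
  \<open>\<sigma> M'\<close> of the memory is left over.\<close>

lemma E'_le:
  obtains d where "0 < d" "\<And>t. 0 \<le> t \<Longrightarrow> E' t \<le> - d * dissipated t - \<sigma> * M' t"
proof
  define d where "d = min (2 * (\<alpha> - \<tau> * k)) (b * k - c\<^sup>2)"
  show "0 < d" using k by (simp add: d_def)
  fix t :: real assume t: "0 \<le> t"
  define \<kappa> where "\<kappa> = k - \<sigma>"
  have \<kappa>: "0 < \<kappa>" using pos by (simp add: \<kappa>_def)
  define A2 where "A2 = u2 t \<bullet> u2 t"
  define B0 where "B0 = U t \<bullet> U t"
  define B1 where "B1 = U1 t \<bullet> U1 t"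
  define X where "X = U t \<bullet> U1 t"
  define I where "I = integral {0..t} (\<lambda>s. - g' (t - s) * ((U t - U s) \<bullet> U1 t))"
  have nonneg: "0 \<le> A2" "0 \<le> B0" "0 \<le> B1"
    by (simp_all add: A2_def B0_def B1_def)
  have "continuous_on {0..} (\<lambda>r. - g' r)"
    by (intro continuous_intros g')
  from memory_cross_ge[OF this U_cont _ \<kappa>, of t "U1 t"]
  have 1: "- (\<kappa> * M' t + (g 0 - g t) * B1 / \<kappa>) \<le> 2 * I"
    using g'_le integral_g'[OF t] by (simp add: M'_def I_def B1_def)
  have "g t * - (\<kappa> * B0 + B1 / \<kappa>) \<le> g t * (2 * X)"
    unfolding B0_def B1_def X_def using g_pos[OF t]
    by (intro mult_left_mono inner_ge_weighted \<kappa>) auto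
  then have 2: "- (\<kappa> * (g t * B0) + g t * B1 / \<kappa>) \<le> 2 * g t * X"
    by (simp add: algebra_simps)
  have "g 0 / \<kappa> \<le> b * k - c\<^sup>2"
    using g0 \<kappa> by (simp add: \<kappa>_def field_simps)
  then have "g 0 / \<kappa> * B1 \<le> (b * k - c\<^sup>2) * B1"
    using nonneg(3) by (rule mult_right_mono)
  then have 3: "(g 0 - g t) * B1 / \<kappa> + g t * B1 / \<kappa> \<le> (b * k - c\<^sup>2) * B1"
    by (simp add: diff_divide_distrib left_diff_distrib)
  have 4: "k * M' t = \<kappa> * M' t + \<sigma> * M' t" "k * g t * B0 = \<kappa> * (g t * B0) + \<sigma> * (g t * B0)"
    by (simp_all add: \<kappa>_def algebra_simps)
  have 5: "0 \<le> \<sigma> * (g t * B0)"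
    using pos g_pos[OF t] nonneg by simp
  have "d * A2 \<le> 2 * (\<alpha> - \<tau> * k) * A2" "d * B1 \<le> (b * k - c\<^sup>2) * B1"
    using nonneg by (auto intro!: mult_right_mono simp: d_def)
  then have 6: "d * dissipated t \<le> 2 * (\<alpha> - \<tau> * k) * A2 + (b * k - c\<^sup>2) * B1"
    by (simp add: dissipated_def A2_def B1_def distrib_left)
  have "E' t = - 2 * (\<alpha> - \<tau> * k) * A2 - 2 * ((b * k - c\<^sup>2) * B1) - k * M' t - k * g t * B0 - 2 * g t * X - 2 * I"
    by (simp add: E'_def A2_def B0_def B1_def X_def I_def)
  with 1 2 3 4 5 6 show "E' t \<le> - d * dissipated t - \<sigma> * M' t"
    by linarith
qed

lemma E_antimono: "0 \<le> s \<Longrightarrow> s \<le> t \<Longrightarrow> E t \<le> E s"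
proof -
  obtain d where d: "0 < d" "\<And>t. 0 \<le> t \<Longrightarrow> E' t \<le> - d * dissipated t - \<sigma> * M' t"
    using E'_le by blast
  have "E' t \<le> 0" if "0 \<le> t" for t
  proof -
    have "0 \<le> d * dissipated t + \<sigma> * M' t"
      using d(1) pos dissipated_nonneg M'_nonneg by simp
    then show ?thesis using d(2)[OF that] by linarith
  qed
  from nonincreasing_atLeast[OF E this] show "0 \<le> s \<Longrightarrow> s \<le> t \<Longrightarrow> E t \<le> E s"
    by blast
qed

text \<open>The memory cross term is paid for by \<open>k M\<close> and a share of the square of
  \<open>U1\<close>. What remains of the form in \<open>U\<close> and \<open>U1\<close> is completed
  to \<open>\<beta>\<close> times the square of \<open>U1\<close> plus
  \<open>(c\<^sup>2 - G) / k\<close> times that of \<open>k U + U1\<close>; both coefficients are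
  positive, as \<open>c\<^sup>2 < b k\<close> and \<open>G < c\<^sup>2\<close>.\<close>

lemma E_ge:
  obtains e where "0 < e" "\<And>t. 0 \<le> t \<Longrightarrow> e * (dissipated t + U t \<bullet> U t) \<le> E t"
proof
  define \<eta> where "\<eta> = c\<^sup>2 - Ginf"
  define \<beta> where "\<beta> = b - c\<^sup>2 / k"
  \<comment> \<open>The completed squares bound \<open>U\<close> and \<open>u2\<close> only up to
    multiples of \<open>U1\<close> and \<open>u1\<close>. The caps in \<open>\<omega>\<close> and
    \<open>\<omega>'\<close> keep these losses within half of the \<open>U1\<close> term and within
    the \<open>u1\<close> term of the energy.\<close>
  define \<omega> where "\<omega> = min (\<eta> / k) (\<beta> / 2)"
  define \<omega>' where "\<omega>' = min \<tau> ((\<alpha> - \<tau> * k) / k)"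
  define e where "e = min (\<beta> / 2) (min (\<omega> * k\<^sup>2 / 2) (\<omega>' / 2))"
  have c: "0 < \<eta>" "0 < \<beta>" "0 < \<omega>'"
    using Ginf k k_pos pos by (simp_all add: \<eta>_def \<beta>_def \<omega>'_def field_simps)
  then have \<omega>: "0 < \<omega>" using k_pos by (simp add: \<omega>_def)
  then show "0 < e" using c k_pos by (simp add: e_def)
  fix t :: real assume t: "0 \<le> t"
  define A1 where "A1 = u1 t \<bullet> u1 t"
  define A2 where "A2 = u2 t \<bullet> u2 t"
  define B0 where "B0 = U t \<bullet> U t"
  define B1 where "B1 = U1 t \<bullet> U1 t"
  define X where "X = U t \<bullet> U1 t"
  define Y where "Y = (k *\<^sub>R U t + U1 t) \<bullet> (k *\<^sub>R U t + U1 t)"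
  define I where "I = integral {0..t} (\<lambda>s. g (t - s) * ((U t - U s) \<bullet> U1 t))"
  define p where "p = (u2 t + k *\<^sub>R u1 t) \<bullet> (u2 t + k *\<^sub>R u1 t)"
  have nonneg: "0 \<le> A1" "0 \<le> A2" "0 \<le> B0" "0 \<le> B1" "0 \<le> Y" "0 \<le> p"
    by (simp_all add: A1_def A2_def B0_def B1_def Y_def p_def)
  have Y: "Y = k\<^sup>2 * B0 + 2 * (k * X) + B1"
    by (simp add: Y_def B0_def X_def B1_def inner_add_left inner_add_right inner_commute power2_eq_square algebra_simps)
  have 1: "- (k * M t + G t * B1 / k) \<le> 2 * I"
    using memory_cross_ge[OF g_cont U_cont _ k_pos, of t "U1 t"] g_pos integral_g[OF t]
    by (simp add: M_def I_def B1_def less_imp_le)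
  have 2: "b * B1 - G t * B1 / k + 2 * (c\<^sup>2 - G t) * X + k * (c\<^sup>2 - G t) * B0 = \<beta> * B1 + (c\<^sup>2 - G t) / k * Y"
    using k_pos by (simp add: Y \<beta>_def field_simps power2_eq_square)
  have "\<omega> \<le> (c\<^sup>2 - G t) / k"
    using G_le[OF t] k_pos by (auto simp: \<omega>_def \<eta>_def min_def field_simps)
  then have 3: "\<omega> * Y \<le> (c\<^sup>2 - G t) / k * Y"
    using nonneg by (intro mult_right_mono)
  have "- (k / 2 * B0 + B1 / (k / 2)) \<le> 2 * X"
    unfolding B0_def B1_def X_def using k_pos by (intro inner_ge_weighted) auto
  then have "k * - (k / 2 * B0 + B1 / (k / 2)) \<le> k * (2 * X)"
    using k_pos by (intro mult_left_mono) auto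
  moreover have "k * - (k / 2 * B0 + B1 / (k / 2)) = - (k\<^sup>2 / 2 * B0) - 2 * B1"
    using k_pos by (simp add: field_simps power2_eq_square)
  ultimately have "k\<^sup>2 / 2 * B0 - B1 \<le> Y"
    using Y by linarith
  then have "\<omega> * (k\<^sup>2 / 2 * B0 - B1) \<le> \<omega> * Y"
    using \<omega> by (intro mult_left_mono) auto
  then have 4: "\<omega> * k\<^sup>2 / 2 * B0 - \<omega> * B1 \<le> \<omega> * Y"
    by (simp add: algebra_simps)
  have "\<omega> \<le> \<beta> / 2" unfolding \<omega>_def by (rule min.cobounded2)
  then have 5: "\<omega> * B1 \<le> \<beta> / 2 * B1"
    using nonneg(4) by (rule mult_right_mono)
  have "- (1 / 2 * A2 + (k *\<^sub>R u1 t \<bullet> k *\<^sub>R u1 t) / (1 / 2)) \<le> 2 * (u2 t \<bullet> k *\<^sub>R u1 t)"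
    unfolding A2_def by (rule inner_ge_weighted) simp
  then have "A2 / 2 - k\<^sup>2 * A1 \<le> p"
    by (simp add: p_def A1_def A2_def inner_add_left inner_add_right inner_commute power2_eq_square algebra_simps)
  then have "\<omega>' * (A2 / 2 - k\<^sup>2 * A1) \<le> \<omega>' * p"
    using c by (intro mult_left_mono) auto
  then have 6: "\<omega>' / 2 * A2 - \<omega>' * k\<^sup>2 * A1 \<le> \<omega>' * p"
    by (simp add: algebra_simps)
  have 7: "\<omega>' * p \<le> \<tau> * p"
    using nonneg by (intro mult_right_mono) (simp_all add: \<omega>'_def)
  have "\<omega>' * k\<^sup>2 \<le> (\<alpha> - \<tau> * k) / k * k\<^sup>2"
    by (intro mult_right_mono) (simp_all add: \<omega>'_def)
  also have "\<dots> = k * (\<alpha> - \<tau> * k)"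
    using k_pos by (simp add: power2_eq_square)
  finally have 8: "\<omega>' * k\<^sup>2 * A1 \<le> k * (\<alpha> - \<tau> * k) * A1"
    using nonneg by (intro mult_right_mono)
  have "k * \<tau> * (\<alpha> / \<tau> - k) = k * (\<alpha> - \<tau> * k)"
    using pos by (simp add: field_simps)
  then have "E t = b * B1 + 2 * (c\<^sup>2 - G t) * X + k * (c\<^sup>2 - G t) * B0 + \<tau> * p
      + k * (\<alpha> - \<tau> * k) * A1 + k * M t + 2 * I"
    unfolding E_def power2_norm_eq_inner
    by (simp add: A1_def B0_def B1_def X_def p_def M_def I_def algebra_simps)
  moreover have "e \<le> \<omega>' / 2" "e \<le> \<omega> * k\<^sup>2 / 2" "e \<le> \<beta> / 2"
    unfolding e_def by linarith+
  then have "e * A2 \<le> \<omega>' / 2 * A2" "e * B0 \<le> \<omega> * k\<^sup>2 / 2 * B0" "e * B1 \<le> \<beta> / 2 * B1"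
    using nonneg by (simp_all only: mult_right_mono)
  moreover have "e * (dissipated t + U t \<bullet> U t) = e * A2 + e * B1 + e * B0"
    by (simp add: dissipated_def A2_def B1_def B0_def algebra_simps)
  ultimately show "e * (dissipated t + U t \<bullet> U t) \<le> E t"
    using 1 2 3 4 5 6 7 8 by linarith
qed

lemma E_nonneg: "0 \<le> t \<Longrightarrow> 0 \<le> E t"
proof -
  obtain e where e: "0 < e" "\<And>t. 0 \<le> t \<Longrightarrow> e * (dissipated t + U t \<bullet> U t) \<le> E t"
    using E_ge by blast
  assume "0 \<le> t"
  moreover have "0 \<le> e * (dissipated t + U t \<bullet> U t)"
    using e(1) dissipated_nonneg by simp
  ultimately show ?thesis using e(2)[of t] by linarith
qed

text \<open>The Poincare inequality removes \<open>u1\<close>. \<open>M\<close> depends on the whole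
  past and therefore remains on the right.\<close>

lemma E_le:
  obtains e where "0 < e" "\<And>t. 0 \<le> t \<Longrightarrow> E t \<le> e * (dissipated t + U t \<bullet> U t + M t)"
proof
  define C1 where "C1 = b + c\<^sup>2 + 2 * \<tau> * k\<^sup>2 * lam\<^sup>2 + k * (\<alpha> - \<tau> * k) * lam\<^sup>2 + c\<^sup>2 / k"
  define C0 where "C0 = c\<^sup>2 + k * c\<^sup>2"
  define e where "e = max C1 (max C0 (max (2 * \<tau>) (2 * k)))"
  show "0 < e" using pos by (simp add: e_def less_max_iff_disj)
  fix t :: real assume t: "0 \<le> t"
  define A1 where "A1 = u1 t \<bullet> u1 t"
  define A2 where "A2 = u2 t \<bullet> u2 t"
  define B0 where "B0 = U t \<bullet> U t"
  define B1 where "B1 = U1 t \<bullet> U1 t"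
  define X where "X = U t \<bullet> U1 t"
  define I where "I = integral {0..t} (\<lambda>s. g (t - s) * ((U t - U s) \<bullet> U1 t))"
  define p where "p = (u2 t + k *\<^sub>R u1 t) \<bullet> (u2 t + k *\<^sub>R u1 t)"
  define q where "q = c\<^sup>2 - G t"
  have q: "0 \<le> q" "q \<le> c\<^sup>2"
    using G_lt[OF t] G_nonneg by (simp_all add: q_def)
  have nonneg: "0 \<le> A1" "0 \<le> A2" "0 \<le> B0" "0 \<le> B1" "0 \<le> p"
    by (simp_all add: A1_def A2_def B0_def B1_def p_def)
  have 1: "2 * I \<le> k * M t + G t * B1 / k"
    using memory_cross_le[OF g_cont U_cont _ k_pos, of t "U1 t"] g_pos integral_g[OF t]
    by (simp add: M_def I_def B1_def less_imp_le)
  have "G t * B1 \<le> c\<^sup>2 * B1"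
    using G_lt[OF t] nonneg by (intro mult_right_mono) auto
  then have 2: "G t * B1 / k \<le> c\<^sup>2 / k * B1"
    using k_pos by (simp add: field_simps)
  have "2 * X \<le> B0 + B1"
    using inner_le_weighted[of 1 "U t" "U1 t"] by (simp add: X_def B0_def B1_def)
  then have "q * (2 * X) \<le> q * (B0 + B1)"
    using q by (intro mult_left_mono)
  also have "\<dots> \<le> c\<^sup>2 * (B0 + B1)"
    using q nonneg by (intro mult_right_mono) auto
  finally have 3: "2 * q * X \<le> c\<^sup>2 * B0 + c\<^sup>2 * B1"
    by (simp add: algebra_simps)
  have "q * B0 \<le> c\<^sup>2 * B0"
    using q nonneg by (intro mult_right_mono)
  then have 4: "k * q * B0 \<le> k * c\<^sup>2 * B0"
    using k_pos by (simp add: mult.assoc)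
  have "2 * (u2 t \<bullet> k *\<^sub>R u1 t) \<le> 1 * A2 + (k *\<^sub>R u1 t \<bullet> k *\<^sub>R u1 t) / 1"
    unfolding A2_def by (rule inner_le_weighted) simp
  then have "p \<le> 2 * A2 + 2 * k\<^sup>2 * A1"
    by (simp add: p_def A1_def A2_def inner_add_left inner_add_right inner_commute power2_eq_square algebra_simps)
  then have "\<tau> * p \<le> \<tau> * (2 * A2 + 2 * k\<^sup>2 * A1)"
    using pos by (intro mult_left_mono) auto
  then have 5: "\<tau> * p \<le> 2 * \<tau> * A2 + 2 * \<tau> * k\<^sup>2 * A1"
    by (simp add: algebra_simps)
  have A1: "A1 \<le> lam\<^sup>2 * B1"
    using norm_u1_le[OF t] by (simp add: A1_def B1_def)
  have 6: "2 * \<tau> * k\<^sup>2 * A1 \<le> 2 * \<tau> * k\<^sup>2 * lam\<^sup>2 * B1"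
    using mult_left_mono[OF A1, of "2 * \<tau> * k\<^sup>2"] pos by (simp add: mult.assoc)
  have 7: "k * (\<alpha> - \<tau> * k) * A1 \<le> k * (\<alpha> - \<tau> * k) * lam\<^sup>2 * B1"
    using mult_left_mono[OF A1, of "k * (\<alpha> - \<tau> * k)"] k k_pos by (simp add: mult.assoc)
  have "k * \<tau> * (\<alpha> / \<tau> - k) = k * (\<alpha> - \<tau> * k)"
    using pos by (simp add: field_simps)
  then have "E t = b * B1 + 2 * q * X + k * q * B0 + \<tau> * p
      + k * (\<alpha> - \<tau> * k) * A1 + k * M t + 2 * I"
    unfolding E_def power2_norm_eq_inner
    by (simp add: A1_def B0_def B1_def X_def p_def M_def I_def q_def algebra_simps)
  moreover have "C1 * B1 = b * B1 + c\<^sup>2 * B1 + 2 * \<tau> * k\<^sup>2 * lam\<^sup>2 * B1 + k * (\<alpha> - \<tau> * k) * lam\<^sup>2 * B1 + c\<^sup>2 / k * B1"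
    by (simp only: C1_def distrib_right)
  moreover have "C0 * B0 = c\<^sup>2 * B0 + k * c\<^sup>2 * B0"
    by (simp only: C0_def distrib_right)
  moreover have "2 * \<tau> * A2 \<le> e * A2" "C0 * B0 \<le> e * B0" "C1 * B1 \<le> e * B1" "2 * k * M t \<le> e * M t"
    using nonneg M_nonneg by (auto intro!: mult_right_mono simp: e_def)
  moreover have "e * (dissipated t + U t \<bullet> U t + M t) = e * A2 + e * B1 + e * B0 + e * M t"
    by (simp add: dissipated_def A2_def B1_def B0_def algebra_simps)
  ultimately show "E t \<le> e * (dissipated t + U t \<bullet> U t + M t)"
    using 1 2 3 4 5 6 7 by linarith
qed

section \<open>The multiplier \<open>u\<close> and integrability in time\<close>

definition P :: "real \<Rightarrow> real" where "P t = \<tau> * (u2 t \<bullet> u t)"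

definition P' :: "real \<Rightarrow> real" where
  "P' t = (- \<alpha> *\<^sub>R u2 t) \<bullet> u t - (c\<^sup>2 *\<^sub>R U t + b *\<^sub>R U1 t - convol g U t) \<bullet> U t + \<tau> * (u2 t \<bullet> u1 t)"

definition J :: "real \<Rightarrow> real" where "J t = integral {0..t} (\<lambda>s. U s \<bullet> U s)"

text \<open>The primitive of \<open>Z'\<close> that vanishes at 0, because \<open>G\<close> has
  derivative \<open>g\<close> and \<open>G 0 = 0\<close>. The bound \<open>G \<le> Ginf\<close>
  turns into \<open>Z \<le> Ginf J\<close>, the integrated form of the convolution estimate.\<close>

definition Z :: "real \<Rightarrow> real" where "Z = convol G (\<lambda>s. U s \<bullet> U s)"

definition Z' :: "real \<Rightarrow> real" where "Z' = convol g (\<lambda>s. U s \<bullet> U s)"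

lemma P: "0 \<le> t \<Longrightarrow> (P has_vector_derivative P' t) (at t within {0..})"
  unfolding P_def[abs_def] P'_def
  by (rule weak_product_rule[where D = D, OF u2 _ _ weak D(2) u u1_cont U_cont];
      (intro continuous_intros u2 U_cont U1 continuous_on_convol g_cont)?)

lemma N_cont: "continuous_on {0..} (\<lambda>s. U s \<bullet> U s)"
  by (intro continuous_intros U_cont)

lemma J: "0 \<le> t \<Longrightarrow> (J has_vector_derivative U t \<bullet> U t) (at t within {0..})"
  unfolding J_def[abs_def] by (rule integral_has_vector_derivative_atLeast[OF N_cont])

lemma G_cont: "continuous_on {0..} G"
  using G by (intro continuous_on_vector_derivative) auto

lemma Z: "0 \<le> t \<Longrightarrow> (Z has_vector_derivative Z' t) (at t within {0..})"
  using convol_has_vector_derivative[OF G g_cont N_cont, of t]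
  by (simp add: Z_def Z'_def memory_integral_def)

lemma Z_le: "0 \<le> t \<Longrightarrow> Z t \<le> Ginf * J t"
proof -
  assume "0 \<le> t"
  have "Z t \<le> integral {0..t} (\<lambda>s. Ginf *\<^sub>R (U s \<bullet> U s))"
    unfolding Z_def convol_def
  proof (rule integral_le)
    show "(\<lambda>s. G (t - s) *\<^sub>R (U s \<bullet> U s)) integrable_on {0..t}"
      by (rule convol_integrable[OF G_cont N_cont])
    show "(\<lambda>s. Ginf *\<^sub>R (U s \<bullet> U s)) integrable_on {0..t}"
      by (intro integrable_continuous_interval continuous_intros continuous_on_subset[OF U_cont]) auto
  qed (auto intro!: mult_right_mono G_le)
  then show ?thesis by (simp add: J_def)
qed

lemma P_bound:
  obtains p where "0 < p" "\<And>t. 0 \<le> t \<Longrightarrow> \<bar>P t\<bar> \<le> p * E t"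
proof -
  obtain e where e: "0 < e" "\<And>t. 0 \<le> t \<Longrightarrow> e * (dissipated t + U t \<bullet> U t) \<le> E t"
    using E_ge by blast
  define q where "q = \<tau> * (1 + lam\<^sup>2) / 2"
  have q: "0 < q" using pos by (simp add: q_def add_pos_nonneg)
  show ?thesis
  proof (rule that[of "q / e"])
    show "0 < q / e" using q e by simp
    fix t :: real assume t: "0 \<le> t"
    have nonneg: "0 \<le> u2 t \<bullet> u2 t" "0 \<le> U t \<bullet> U t" "0 \<le> U1 t \<bullet> U1 t" by simp_all
    have "2 * \<bar>u2 t \<bullet> u t\<bar> \<le> u2 t \<bullet> u2 t + u t \<bullet> u t"
      using inner_le_weighted[of 1 "u2 t" "u t"] inner_ge_weighted[of 1 "u2 t" "u t"] by simp
    also have "\<dots> \<le> u2 t \<bullet> u2 t + lam\<^sup>2 * (U t \<bullet> U t)"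
      using norm_u_le[OF t] by simp
    also have "\<dots> \<le> (1 + lam\<^sup>2) * (dissipated t + U t \<bullet> U t)"
      using nonneg by (simp add: dissipated_def algebra_simps)
    finally have "\<tau> / 2 * (2 * \<bar>u2 t \<bullet> u t\<bar>) \<le> \<tau> / 2 * ((1 + lam\<^sup>2) * (dissipated t + U t \<bullet> U t))"
      using pos by (intro mult_left_mono) auto
    then have "\<bar>P t\<bar> \<le> q * (dissipated t + U t \<bullet> U t)"
      using pos by (simp add: P_def abs_mult q_def)
    also have "\<dots> \<le> q / e * E t"
      using mult_left_mono[OF e(2)[OF t], of "q / e"] q e(1) by simp
    finally show "\<bar>P t\<bar> \<le> q / e * E t" .
  qed
qed

text \<open>Each of the two mixed terms costs half of \<open>\<eta>\<close> times the square of
  \<open>U\<close>, the one with \<open>u\<close> after the Poincare inequality, hence the weight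
  \<open>\<eta> / lam\<^sup>2\<close>. \<open>\<eta>\<close> is left free because the bound on
  \<open>J\<close> and the Lyapunov function spend different shares of
  \<open>c\<^sup>2 - Ginf\<close>.\<close>

lemma P'_le:
  assumes \<eta>: "0 < \<eta>"
  obtains p where "0 < p"
    "\<And>t. 0 \<le> t \<Longrightarrow> P' t \<le> convol g U t \<bullet> U t - (c\<^sup>2 - \<eta>) * (U t \<bullet> U t) + p * dissipated t"
proof
  define e where "e = \<eta> / lam\<^sup>2"
  have e: "0 < e" using \<eta> pos by (simp add: e_def)
  define q where "q = \<alpha>\<^sup>2 / e + \<tau> + b\<^sup>2 / \<eta> + \<tau> * lam\<^sup>2"
  have q: "\<alpha>\<^sup>2 / e + \<tau> \<le> q" "b\<^sup>2 / \<eta> + \<tau> * lam\<^sup>2 \<le> q"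
    using \<eta> e pos by (simp_all add: q_def)
  show "0 < q"
    using \<eta> e pos by (simp add: q_def add_pos_pos add_pos_nonneg)
  fix t :: real assume t: "0 \<le> t"
  have nonneg: "0 \<le> u2 t \<bullet> u2 t" "0 \<le> U t \<bullet> U t" "0 \<le> U1 t \<bullet> U1 t" by simp_all
  have "- (e * (u t \<bullet> u t) + (\<alpha> *\<^sub>R u2 t \<bullet> \<alpha> *\<^sub>R u2 t) / e) \<le> 2 * (u t \<bullet> \<alpha> *\<^sub>R u2 t)"
    by (rule inner_ge_weighted[OF e])
  moreover have "e * (u t \<bullet> u t) \<le> \<eta> * (U t \<bullet> U t)"
    using mult_left_mono[OF norm_u_le[OF t], of e] e pos by (simp add: e_def)
  ultimately have 1: "- 2 * (\<alpha> * (u2 t \<bullet> u t)) \<le> \<eta> * (U t \<bullet> U t) + \<alpha>\<^sup>2 / e * (u2 t \<bullet> u2 t)"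
    by (simp add: inner_commute power2_eq_square mult.assoc)
  have "- (\<eta> * (U t \<bullet> U t) + (b *\<^sub>R U1 t \<bullet> b *\<^sub>R U1 t) / \<eta>) \<le> 2 * (U t \<bullet> b *\<^sub>R U1 t)"
    by (rule inner_ge_weighted[OF \<eta>])
  then have 2: "- 2 * (b * (U1 t \<bullet> U t)) \<le> \<eta> * (U t \<bullet> U t) + b\<^sup>2 / \<eta> * (U1 t \<bullet> U1 t)"
    by (simp add: inner_commute power2_eq_square mult.assoc)
  have "2 * (u2 t \<bullet> u1 t) \<le> u2 t \<bullet> u2 t + u1 t \<bullet> u1 t"
    using inner_le_weighted[of 1 "u2 t" "u1 t"] by simp
  also have "\<dots> \<le> u2 t \<bullet> u2 t + lam\<^sup>2 * (U1 t \<bullet> U1 t)"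
    using norm_u1_le[OF t] by simp
  finally have "\<tau> * (2 * (u2 t \<bullet> u1 t)) \<le> \<tau> * (u2 t \<bullet> u2 t + lam\<^sup>2 * (U1 t \<bullet> U1 t))"
    using pos by (intro mult_left_mono) auto
  then have 3: "2 * (\<tau> * (u2 t \<bullet> u1 t)) \<le> \<tau> * (u2 t \<bullet> u2 t) + \<tau> * lam\<^sup>2 * (U1 t \<bullet> U1 t)"
    by (simp add: algebra_simps)
  have 4: "(\<alpha>\<^sup>2 / e + \<tau>) * (u2 t \<bullet> u2 t) \<le> q * (u2 t \<bullet> u2 t)"
    "(b\<^sup>2 / \<eta> + \<tau> * lam\<^sup>2) * (U1 t \<bullet> U1 t) \<le> q * (U1 t \<bullet> U1 t)"
    "0 \<le> q * (u2 t \<bullet> u2 t)" "0 \<le> q * (U1 t \<bullet> U1 t)"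
    using nonneg q \<open>0 < q\<close> by (simp_all add: mult_right_mono)
  have "P' t = convol g U t \<bullet> U t - c\<^sup>2 * (U t \<bullet> U t) - \<alpha> * (u2 t \<bullet> u t) - b * (U1 t \<bullet> U t) + \<tau> * (u2 t \<bullet> u1 t)"
    by (simp add: P'_def inner_add_left inner_diff_left)
  moreover have "q * dissipated t = q * (u2 t \<bullet> u2 t) + q * (U1 t \<bullet> U1 t)"
    by (simp add: dissipated_def distrib_left)
  moreover have "(c\<^sup>2 - \<eta>) * (U t \<bullet> U t) = c\<^sup>2 * (U t \<bullet> U t) - \<eta> * (U t \<bullet> U t)"
    by (simp add: algebra_simps)
  ultimately show "P' t \<le> convol g U t \<bullet> U t - (c\<^sup>2 - \<eta>) * (U t \<bullet> U t) + q * dissipated t"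
    using 1 2 3 4 unfolding distrib_right by linarith
qed

text \<open>Polarisation. Dropping \<open>- M\<close> leaves a bound whose time integral is at most
  \<open>2 Ginf J\<close>.\<close>

lemma convol_inner_eq:
  assumes t: "0 \<le> t"
  shows "2 * (convol g U t \<bullet> U t) = G t * (U t \<bullet> U t) + Z' t - M t"
  using memory_circ_eq[OF g_cont U_cont, of t] integral_g[OF t] by (simp add: M_def Z'_def)

lemma G_inner_le: "0 \<le> t \<Longrightarrow> G t * (U t \<bullet> U t) \<le> Ginf * (U t \<bullet> U t)"
  by (intro mult_right_mono G_le) auto

text \<open>An integrable majorant of \<open>M\<close>: each term on the right has time integral at
  most \<open>2 Ginf J\<close>.\<close>

lemma M_le:
  assumes t: "0 \<le> t"
  shows "M t \<le> 2 * (G t * (U t \<bullet> U t)) + 2 * Z' t"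
proof -
  have "M t \<le> integral {0..t} (\<lambda>s. g (t - s) * (2 * (U t \<bullet> U t)) + 2 * (g (t - s) *\<^sub>R (U s \<bullet> U s)))"
    unfolding M_def memory_circ_def
  proof (rule integral_le)
    fix s assume s: "s \<in> {0..t}"
    have "(norm (U t - U s))\<^sup>2 \<le> 2 * (U t \<bullet> U t) + 2 * (U s \<bullet> U s)"
      using inner_ge_weighted[of 1 "U t" "U s"]
      by (simp add: power2_norm_eq_inner inner_diff_left inner_diff_right inner_commute[of "U s" "U t"])
    then have "g (t - s) * (norm (U t - U s))\<^sup>2 \<le> g (t - s) * (2 * (U t \<bullet> U t) + 2 * (U s \<bullet> U s))"
      using s g_pos[of "t - s"] by (intro mult_left_mono) auto
    then show "g (t - s) * (norm (U t - U s))\<^sup>2 \<le>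
        g (t - s) * (2 * (U t \<bullet> U t)) + 2 * (g (t - s) *\<^sub>R (U s \<bullet> U s))"
      by (simp add: algebra_simps)
  next
    show "(\<lambda>s. g (t - s) * (norm (U t - U s))\<^sup>2) integrable_on {0..t}"
      by (intro integrable_continuous_interval continuous_on_mult continuous_on_power continuous_on_norm
          continuous_on_diff continuous_on_const continuous_on_memory[OF g_cont U_cont])
    show "(\<lambda>s. g (t - s) * (2 * (U t \<bullet> U t)) + 2 * (g (t - s) *\<^sub>R (U s \<bullet> U s))) integrable_on {0..t}"
      by (intro integrable_continuous_interval continuous_on_add continuous_on_mult continuous_on_scaleR
          continuous_on_const continuous_on_inner continuous_on_memory[OF g_cont U_cont])
  qed
  also have "\<dots> = 2 * (G t * (U t \<bullet> U t)) + 2 * Z' t"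
  proof -
    have "(\<lambda>s. g (t - s) * (2 * (U t \<bullet> U t))) integrable_on {0..t}"
      "(\<lambda>s. 2 * (g (t - s) *\<^sub>R (U s \<bullet> U s))) integrable_on {0..t}"
      by (intro integrable_continuous_interval continuous_on_mult continuous_on_scaleR
          continuous_on_const continuous_on_inner continuous_on_memory[OF g_cont U_cont])+
    from Henstock_Kurzweil_Integration.integral_add[OF this] show ?thesis
      by (simp add: Z'_def convol_def integral_g[OF t])
  qed
  finally show ?thesis .
qed

text \<open>The convolution operator with kernel \<open>g\<close> has norm at most \<open>Ginf < c\<^sup>2\<close> on \<open>L\<^sup>2\<close>, so multiplying
  the equation by \<open>u\<close> bounds the square integral of \<open>U\<close> without any decay of \<open>g\<close>.\<close>

lemma J_bounded:
  obtains K where "0 < K" "\<And>t. 0 \<le> t \<Longrightarrow> J t \<le> K"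
proof -
  define \<eta> where "\<eta> = (c\<^sup>2 - Ginf) / 2"
  have \<eta>: "0 < \<eta>" using Ginf by (simp add: \<eta>_def)
  obtain p where p: "0 < p" "\<And>t. 0 \<le> t \<Longrightarrow>
      P' t \<le> convol g U t \<bullet> U t - (c\<^sup>2 - \<eta>) * (U t \<bullet> U t) + p * dissipated t"
    using P'_le[OF \<eta>] by blast
  obtain q where q: "0 < q" "\<And>t. 0 \<le> t \<Longrightarrow> \<bar>P t\<bar> \<le> q * E t"
    using P_bound by blast
  obtain d where d: "0 < d" "\<And>t. 0 \<le> t \<Longrightarrow> E' t \<le> - d * dissipated t - \<sigma> * M' t"
    using E'_le by blast
  \<comment> \<open>Large enough for \<open>N E\<close> both to absorb \<open>p * dissipated\<close>
    and to dominate the absolute value of \<open>P\<close>.\<close>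
  define N where "N = max (p / d) q"
  have N: "p \<le> N * d" "q \<le> N" "0 \<le> N"
    using p(1) q(1) d(1) by (auto simp: N_def field_simps max_def)
  \<comment> \<open>One half of \<open>Ginf\<close> is charged here, the other through
    \<open>Z \<le> Ginf J\<close>. As \<open>c\<^sup>2 - Ginf = 2 * \<eta>\<close>, exactly
    \<open>\<eta> J\<close> is left.\<close>
  define a where "a = c\<^sup>2 - \<eta> - Ginf / 2"
  define \<Phi> where "\<Phi> t = N * E t + P t - Z t / 2 + a * J t" for t
  have \<Phi>: "(\<Phi> has_vector_derivative N * E' t + P' t - Z' t / 2 + a * (U t \<bullet> U t)) (at t within {0..})" if "0 \<le> t" for t
    unfolding \<Phi>_def[abs_def]
    by (intro has_vector_derivative_add has_vector_derivative_diff P J E Z that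
        bounded_linear.has_vector_derivative[OF bounded_linear_mult_right]
        bounded_linear.has_vector_derivative[OF bounded_linear_divide])
  have "N * E' t + P' t - Z' t / 2 + a * (U t \<bullet> U t) \<le> 0" if t: "0 \<le> t" for t
  proof -
    have "0 \<le> \<sigma> * M' t" using pos M'_nonneg by simp
    then have "E' t \<le> - d * dissipated t" using d(2)[OF t] by linarith
    then have "N * E' t \<le> N * (- d * dissipated t)"
      using N by (intro mult_left_mono)
    moreover have "p * dissipated t \<le> N * d * dissipated t"
      using N dissipated_nonneg by (intro mult_right_mono)
    moreover have "a * (U t \<bullet> U t) = (c\<^sup>2 - \<eta>) * (U t \<bullet> U t) - Ginf * (U t \<bullet> U t) / 2"
      by (simp add: a_def algebra_simps)
    ultimately show ?thesis
      using p(2)[OF t] convol_inner_eq[OF t] G_inner_le[OF t] M_nonneg[of t] by (simp add: mult.assoc)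
  qed
  then have "\<Phi> t \<le> \<Phi> 0" if "0 \<le> t" for t
    using nonincreasing_atLeast[OF \<Phi>] that by blast
  moreover have "\<eta> * J t \<le> \<Phi> t" if t: "0 \<le> t" for t
  proof -
    have "\<bar>P t\<bar> \<le> N * E t"
      using q(2)[OF t] mult_right_mono[OF N(2) E_nonneg[OF t]] by linarith
    moreover have "\<eta> * J t = a * J t - Ginf * J t / 2"
      by (simp add: a_def \<eta>_def algebra_simps field_simps)
    ultimately show ?thesis
      using Z_le[OF t] by (simp add: \<Phi>_def)
  qed
  ultimately have "\<eta> * J t \<le> \<Phi> 0" if "0 \<le> t" for t
    using that by (meson order_trans)
  then have "J t \<le> \<Phi> 0 / \<eta>" if "0 \<le> t" for t
    using that \<eta> by (simp add: pos_le_divide_eq mult.commute)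
  then show ?thesis
    using that[of "max (\<Phi> 0 / \<eta>) 1"] by (simp add: le_max_iff_disj)
qed

lemma E_decay:
  obtains K where "0 < K" "\<And>t. 0 \<le> t \<Longrightarrow> t * E t \<le> K"
proof -
  obtain e where e: "0 < e" "\<And>t. 0 \<le> t \<Longrightarrow> E t \<le> e * (dissipated t + U t \<bullet> U t + M t)"
    using E_le by blast
  obtain d where d: "0 < d" "\<And>t. 0 \<le> t \<Longrightarrow> E' t \<le> - d * dissipated t - \<sigma> * M' t"
    using E'_le by blast
  obtain KJ where KJ: "0 < KJ" "\<And>t. 0 \<le> t \<Longrightarrow> J t \<le> KJ"
    using J_bounded by blast
  \<comment> \<open>The summand 1 serves the square of \<open>U\<close> in the upper bound of
    \<open>E\<close>, and \<open>2 * Ginf\<close> the first part of the majorant of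
    \<open>M\<close>.\<close>
  define a where "a = e * (1 + 2 * Ginf)"
  have a: "0 < a" using e Ginf by (simp add: a_def)
  have E_cont: "continuous_on {0..} E"
    using E by (intro continuous_on_vector_derivative) auto
  define I where "I t = integral {0..t} E" for t
  have I: "(I has_vector_derivative E t) (at t within {0..})" if "0 \<le> t" for t
    unfolding I_def[abs_def] by (rule integral_has_vector_derivative_atLeast[OF E_cont that])
  define \<Phi> where "\<Phi> t = I t - a * J t - 2 * e * Z t + e / d * E t" for t
  have \<Phi>: "(\<Phi> has_vector_derivative E t - a * (U t \<bullet> U t) - 2 * e * Z' t + e / d * E' t) (at t within {0..})" if "0 \<le> t" for t
    unfolding \<Phi>_def[abs_def]
    by (intro has_vector_derivative_add has_vector_derivative_diff I J E Z that
        bounded_linear.has_vector_derivative[OF bounded_linear_mult_right])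
  have "E t - a * (U t \<bullet> U t) - 2 * e * Z' t + e / d * E' t \<le> 0" if t: "0 \<le> t" for t
  proof -
    have "0 \<le> \<sigma> * M' t" using pos M'_nonneg by simp
    then have "E' t \<le> - d * dissipated t" using d(2)[OF t] by linarith
    then have "e / d * E' t \<le> e / d * (- d * dissipated t)"
      using e d by (intro mult_left_mono) auto
    then have 1: "e / d * E' t \<le> - (e * dissipated t)" using d(1) by simp
    have "M t \<le> 2 * (Ginf * (U t \<bullet> U t)) + 2 * Z' t"
      using M_le[OF t] G_inner_le[OF t] by linarith
    then have "e * M t \<le> e * (2 * (Ginf * (U t \<bullet> U t)) + 2 * Z' t)"
      using e by (intro mult_left_mono) auto
    then show ?thesis
      using e(2)[OF t] 1 by (simp add: a_def algebra_simps)
  qed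
  then have "\<Phi> t \<le> \<Phi> 0" if "0 \<le> t" for t
    using nonincreasing_atLeast[OF \<Phi>] that by blast
  moreover have "t * E t \<le> \<Phi> t + (a + 2 * e * Ginf) * KJ" if t: "0 \<le> t" for t
  proof -
    have "integral {0..t} (\<lambda>_. E t) \<le> I t"
      unfolding I_def using t E_antimono
      by (intro integral_le integrable_continuous_interval continuous_on_subset[OF E_cont] continuous_intros) auto
    then have "t * E t \<le> I t" using t by simp
    moreover have "Ginf * J t \<le> Ginf * KJ"
      using KJ(2)[OF t] Ginf by simp
    then have "Z t \<le> Ginf * KJ"
      using Z_le[OF t] by linarith
    then have "2 * e * Z t \<le> 2 * e * (Ginf * KJ)"
      using e(1) by simp
    moreover have "a * J t \<le> a * KJ"
      using a KJ(2)[OF t] by simp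
    moreover have "0 \<le> e / d * E t" using e d E_nonneg[OF t] by simp
    ultimately show ?thesis by (simp add: \<Phi>_def algebra_simps)
  qed
  ultimately have "t * E t \<le> \<bar>\<Phi> 0 + (a + 2 * e * Ginf) * KJ\<bar> + 1" if "0 \<le> t" for t
    using that by (smt (verit))
  then show ?thesis
    using that[of "\<bar>\<Phi> 0 + (a + 2 * e * Ginf) * KJ\<bar> + 1"] by auto
qed

text \<open>The interval has length \<open>t\<close>, so the endpoint contributes
  \<open>2 * t\<close> times the square of \<open>U t\<close>. Mere boundedness of \<open>E\<close>
  would not control this; its decay like \<open>1 / t\<close> does.\<close>

lemma displacement_bounded:
  obtains K where "0 < K" "\<And>t. 0 \<le> t \<Longrightarrow> integral {0..t} (\<lambda>s. (norm (U t - U s))\<^sup>2) \<le> K"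
proof -
  obtain e where e: "0 < e" "\<And>t. 0 \<le> t \<Longrightarrow> e * (dissipated t + U t \<bullet> U t) \<le> E t"
    using E_ge by blast
  obtain KE where KE: "0 < KE" "\<And>t. 0 \<le> t \<Longrightarrow> t * E t \<le> KE"
    using E_decay by blast
  obtain KJ where KJ: "0 < KJ" "\<And>t. 0 \<le> t \<Longrightarrow> J t \<le> KJ"
    using J_bounded by blast
  show ?thesis
  proof (rule that[of "2 * (KE / e) + 2 * KJ"])
    show "0 < 2 * (KE / e) + 2 * KJ" using KE KJ e by (simp add: add_pos_pos)
    fix t :: real assume t: "0 \<le> t"
    have "integral {0..t} (\<lambda>s. (norm (U t - U s))\<^sup>2) \<le> integral {0..t} (\<lambda>s. 2 * (U t \<bullet> U t) + 2 * (U s \<bullet> U s))"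
    proof (rule integral_le)
      show "(norm (U t - U s))\<^sup>2 \<le> 2 * (U t \<bullet> U t) + 2 * (U s \<bullet> U s)" for s
        using inner_ge_weighted[of 1 "U t" "U s"]
        by (simp add: power2_norm_eq_inner inner_diff_left inner_diff_right inner_commute[of "U s" "U t"])
    qed (intro integrable_continuous_interval continuous_intros continuous_on_subset[OF U_cont]; auto)+
    also have "\<dots> = 2 * (t * (U t \<bullet> U t)) + 2 * J t"
      unfolding J_def using t
      by (subst Henstock_Kurzweil_Integration.integral_add)
        (auto intro!: integrable_continuous_interval continuous_intros continuous_on_subset[OF U_cont])
    also have "\<dots> \<le> 2 * (KE / e) + 2 * KJ"
    proof -
      have "0 \<le> e * dissipated t" using e dissipated_nonneg by simp
      then have "e * (U t \<bullet> U t) \<le> E t" using e(2)[OF t] by (simp add: distrib_left)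
      then have "t * (e * (U t \<bullet> U t)) \<le> t * E t" using t by (rule mult_left_mono)
      then have "t * (U t \<bullet> U t) \<le> KE / e"
        using KE(2)[OF t] e(1) by (simp add: field_simps)
      then show ?thesis using KJ(2)[OF t] by simp
    qed
    finally show "integral {0..t} (\<lambda>s. (norm (U t - U s))\<^sup>2) \<le> 2 * (KE / e) + 2 * KJ" .
  qed
qed

text \<open>Estimating the convolution through \<open>Z'\<close> would leave a term involving the
  past of \<open>U\<close>. Splitting \<open>U s\<close> into \<open>U t\<close> and a difference
  leaves only the square of \<open>U t\<close> and an error controlled by \<open>M\<close>, which is
  the term that the weight \<open>\<xi>\<close> can handle.\<close>

lemma lyapunov:
  obtains L L' N m K where "0 < N" "0 < m" "0 < K"
    "\<And>t. 0 \<le> t \<Longrightarrow> (L has_vector_derivative L' t) (at t within {0..})"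
    "\<And>t. 0 \<le> t \<Longrightarrow> L' t \<le> - m * E t + K * M t"
    "\<And>t. 0 \<le> t \<Longrightarrow> 0 \<le> L t" "\<And>t. 0 \<le> t \<Longrightarrow> L t \<le> N * E t"
proof -
  define \<eta> where "\<eta> = (c\<^sup>2 - Ginf) / 4"
  have \<eta>: "0 < \<eta>" using Ginf by (simp add: \<eta>_def)
  obtain p where p: "0 < p" "\<And>t. 0 \<le> t \<Longrightarrow>
      P' t \<le> convol g U t \<bullet> U t - (c\<^sup>2 - \<eta>) * (U t \<bullet> U t) + p * dissipated t"
    using P'_le[OF \<eta>] by blast
  obtain q where q: "0 < q" "\<And>t. 0 \<le> t \<Longrightarrow> \<bar>P t\<bar> \<le> q * E t"
    using P_bound by blast
  obtain d where d: "0 < d" "\<And>t. 0 \<le> t \<Longrightarrow> E' t \<le> - d * dissipated t - \<sigma> * M' t"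
    using E'_le by blast
  obtain e where e: "0 < e" "\<And>t. 0 \<le> t \<Longrightarrow> E t \<le> e * (dissipated t + U t \<bullet> U t + M t)"
    using E_le by blast
  \<comment> \<open>The extra \<open>\<eta>\<close> leaves enough dissipation for the multiple
    \<open>\<eta> / e\<close> of \<open>E\<close>.\<close>
  define N where "N = max ((p + \<eta>) / d) q"
  have N: "p + \<eta> \<le> N * d" "q \<le> N" "0 < N"
    using p(1) \<eta> q(1) d(1) by (auto simp: N_def field_simps max_def)
  \<comment> \<open>Chosen so that \<open>Ginf / \<kappa> = 2 * \<eta>\<close>. Of the gap
    \<open>c\<^sup>2 - Ginf = 4 * \<eta>\<close>, one \<open>\<eta>\<close> goes to the mixed terms
    of \<open>P'\<close>, one to the splitting of the convolution and one to the multiple of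
    \<open>E\<close>.\<close>
  define \<kappa> where "\<kappa> = Ginf / (2 * \<eta>)"
  have \<kappa>: "0 < \<kappa>" using Ginf \<eta> by (simp add: \<kappa>_def)
  show ?thesis
  proof (rule that[of "2 * N" "\<eta> / e" "\<eta> + \<kappa> / 2" "\<lambda>t. N * E t + P t" "\<lambda>t. N * E' t + P' t"])
    show "0 < 2 * N" "0 < \<eta> / e" "0 < \<eta> + \<kappa> / 2" using N \<eta> e \<kappa> by simp_all
    fix t :: real assume t: "0 \<le> t"
    show "((\<lambda>t. N * E t + P t) has_vector_derivative N * E' t + P' t) (at t within {0..})"
      by (intro has_vector_derivative_add P E t
          bounded_linear.has_vector_derivative[OF bounded_linear_mult_right])
    have "\<bar>P t\<bar> \<le> N * E t"
      using q(2)[OF t] mult_right_mono[OF N(2) E_nonneg[OF t]] by linarith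
    then show "0 \<le> N * E t + P t" "N * E t + P t \<le> 2 * N * E t"
      by (simp_all add: abs_le_iff mult.assoc)
    have "0 \<le> \<sigma> * M' t" using pos M'_nonneg by simp
    then have "E' t \<le> - d * dissipated t" using d(2)[OF t] by linarith
    then have "N * E' t \<le> N * (- d * dissipated t)"
      using N by (intro mult_left_mono) auto
    moreover have "(p + \<eta>) * dissipated t \<le> N * d * dissipated t"
      using N dissipated_nonneg by (intro mult_right_mono)
    ultimately have 1: "N * E' t \<le> - (p * dissipated t) - \<eta> * dissipated t"
      by (simp add: algebra_simps)
    define I where "I = integral {0..t} (\<lambda>s. g (t - s) * ((U t - U s) \<bullet> U t))"
    have 2: "convol g U t \<bullet> U t = G t * (U t \<bullet> U t) - I"
      unfolding I_def memory_cross_eq[OF g_cont U_cont] integral_g[OF t] by simp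
    have 3: "- (\<kappa> * M t + G t * (U t \<bullet> U t) / \<kappa>) \<le> 2 * I"
      using memory_cross_ge[OF g_cont U_cont _ \<kappa>, of t "U t"] g_pos integral_g[OF t]
      by (simp add: M_def I_def less_imp_le)
    have "G t * (U t \<bullet> U t) / \<kappa> \<le> Ginf * (U t \<bullet> U t) / \<kappa>"
      using G_inner_le[OF t] \<kappa> by (simp add: divide_right_mono)
    also have "\<dots> = 2 * (\<eta> * (U t \<bullet> U t))"
      using Ginf by (simp add: \<kappa>_def)
    finally have 4: "G t * (U t \<bullet> U t) / \<kappa> \<le> 2 * (\<eta> * (U t \<bullet> U t))" .
    have 5: "(c\<^sup>2 - \<eta>) * (U t \<bullet> U t) = Ginf * (U t \<bullet> U t) + 3 * (\<eta> * (U t \<bullet> U t))"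
      by (simp add: \<eta>_def algebra_simps field_simps)
    have "\<eta> / e * E t \<le> \<eta> * (dissipated t + U t \<bullet> U t + M t)"
      using mult_left_mono[OF e(2)[OF t], of "\<eta> / e"] e(1) \<eta> by simp
    then have 6: "\<eta> / e * E t \<le> \<eta> * dissipated t + \<eta> * (U t \<bullet> U t) + \<eta> * M t"
      by (simp add: algebra_simps)
    have 7: "(\<eta> + \<kappa> / 2) * M t = \<eta> * M t + \<kappa> * M t / 2"
      by (simp add: algebra_simps)
    have 8: "0 \<le> \<eta> * (U t \<bullet> U t)" using \<eta> by simp
    show "N * E' t + P' t \<le> - (\<eta> / e) * E t + (\<eta> + \<kappa> / 2) * M t"
      unfolding 7 using 1 2 3 4 5 6 8 p(2)[OF t] G_inner_le[OF t] by linarith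
  qed
qed

end

section \<open>Comparison with the ordinary differential equation\<close>

lemma convex_chord_le:
  fixes H :: "real \<Rightarrow> real"
  assumes H: "convex_on {0..} H" "H 0 = 0" and x: "0 \<le> x" "x \<le> z" "0 < z"
  shows "H x \<le> H z / z * x"
proof -
  have "H ((1 - x / z) *\<^sub>R 0 + (x / z) *\<^sub>R z) \<le> (1 - x / z) * H 0 + (x / z) * H z"
    by (rule convex_onD[OF H(1)]) (use x in auto)
  then show ?thesis using x H(2) by (simp add: mult.commute)
qed

text \<open>A Young inequality without a conjugate function: for \<open>x \<le> z\<close> the left
  side is at most \<open>H z\<close>, and for larger \<open>x\<close> it is at most
  \<open>H x\<close>, since chord slopes from 0 are nondecreasing.\<close>

lemma convex_chord_mult_le:
  fixes H :: "real \<Rightarrow> real"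
  assumes H: "convex_on {0..} H" "H 0 = 0" "\<And>x. 0 \<le> x \<Longrightarrow> 0 \<le> H x" and x: "0 \<le> x" and z: "0 < z"
  shows "H z / z * x \<le> H x + H z"
proof (cases "x \<le> z")
  case True
  then have "H z / z * x \<le> H z / z * z"
    using H(3)[of z] z by (intro mult_left_mono) auto
  then show ?thesis using z H(3)[OF x] by simp
next
  case False
  then have "H z \<le> H x / x * z"
    using z by (intro convex_chord_le H) auto
  then have "H z / z * x \<le> H x"
    using False z by (simp add: field_simps)
  then show ?thesis using H(3)[of z] z by simp
qed

text \<open>On \<open>[0, y 0]\<close> the chord bounds \<open>H\<close> by a linear function, so
  \<open>y\<close> decays at most exponentially. Positivity is needed to divide by the comparison
  function.\<close>

lemma convex_ode_positive:
  fixes H y :: "real \<Rightarrow> real"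
  assumes H: "convex_on {0..} H" "H 0 = 0" "\<And>x. 0 \<le> x \<Longrightarrow> 0 \<le> H x"
    and y: "\<And>t. 0 \<le> t \<Longrightarrow> (y has_real_derivative - H (y t)) (at t within {0..})"
      "\<And>t. 0 \<le> t \<Longrightarrow> 0 \<le> y t" "0 < y 0" and t: "0 \<le> t"
  shows "0 < y t"
proof -
  define m where "m = H (y 0) / y 0"
  have yv: "(y has_vector_derivative - H (y t)) (at t within {0..})" if "0 \<le> t" for t
    using y(1)[OF that] by (simp add: has_real_derivative_iff_has_vector_derivative)
  have y_le: "y t \<le> y 0" if "0 \<le> t" for t
    using nonincreasing_atLeast[OF yv, of 0 t] H(3) y(2) that by auto
  have "- (y t * exp (m * t)) \<le> - (y 0 * exp (m * 0))"
  proof (rule nonincreasing_atLeast[of "\<lambda>t. - (y t * exp (m * t))" "\<lambda>t. (H (y t) - m * y t) * exp (m * t)"])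
    fix t :: real assume t: "0 \<le> t"
    have "((\<lambda>t. - (y t * exp (m * t))) has_real_derivative (H (y t) - m * y t) * exp (m * t)) (at t within {0..})"
      using y(1)[OF t] by (auto intro!: derivative_eq_intros simp: algebra_simps)
    then show "((\<lambda>t. - (y t * exp (m * t))) has_vector_derivative (H (y t) - m * y t) * exp (m * t)) (at t within {0..})"
      by (simp add: has_real_derivative_iff_has_vector_derivative)
    have "H (y t) \<le> m * y t"
      unfolding m_def using y y_le t by (intro convex_chord_le H) auto
    then show "(H (y t) - m * y t) * exp (m * t) \<le> 0"
      by (simp add: mult_nonpos_nonneg)
  qed (use t in auto)
  then have "0 < y t * exp (m * t)" using y(3) by simp
  then show ?thesis by (simp add: zero_less_mult_iff)
qed

lemma differential_inequality_nonpos: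
  fixes f f' \<xi> :: "real \<Rightarrow> real"
  assumes f: "\<And>t. 0 \<le> t \<Longrightarrow> (f has_real_derivative f' t) (at t within {0..})"
    and le: "\<And>t. 0 \<le> t \<Longrightarrow> f' t \<le> - \<xi> t * f t"
    and \<xi>: "continuous_on {0..} \<xi>" and f0: "f 0 \<le> 0" and t: "0 \<le> t"
  shows "f t \<le> 0"
proof -
  define \<Xi> where "\<Xi> t = integral {0..t} \<xi>" for t
  have \<Xi>: "(\<Xi> has_real_derivative \<xi> t) (at t within {0..})" if "0 \<le> t" for t
    unfolding \<Xi>_def[abs_def] has_real_derivative_iff_has_vector_derivative
    by (rule integral_has_vector_derivative_atLeast[OF \<xi> that])
  have "f t * exp (\<Xi> t) \<le> f 0 * exp (\<Xi> 0)"
  proof (rule nonincreasing_atLeast[of "\<lambda>t. f t * exp (\<Xi> t)" "\<lambda>t. (f' t + \<xi> t * f t) * exp (\<Xi> t)"])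
    fix t :: real assume t: "0 \<le> t"
    have "((\<lambda>t. f t * exp (\<Xi> t)) has_real_derivative (f' t + \<xi> t * f t) * exp (\<Xi> t)) (at t within {0..})"
      using f[OF t] \<Xi>[OF t] by (auto intro!: derivative_eq_intros simp: algebra_simps)
    then show "((\<lambda>t. f t * exp (\<Xi> t)) has_vector_derivative (f' t + \<xi> t * f t) * exp (\<Xi> t)) (at t within {0..})"
      by (simp add: has_real_derivative_iff_has_vector_derivative)
    show "(f' t + \<xi> t * f t) * exp (\<Xi> t) \<le> 0"
      using le[OF t] by (intro mult_nonpos_nonneg) auto
  qed (use t in auto)
  also have "\<dots> \<le> 0" using f0 by (simp add: mult_nonpos_nonneg)
  finally show ?thesis by (simp add: mult_le_0_iff)
qed

section \<open>Decay of the energy\<close>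

context mgt_trajectory
begin

lemma E_tendsto_0: "(E \<longlongrightarrow> 0) at_top"
proof -
  obtain K where K: "0 < K" "\<And>t. 0 \<le> t \<Longrightarrow> t * E t \<le> K"
    using E_decay by blast
  show ?thesis
  proof (rule tendsto_sandwich)
    show "eventually (\<lambda>t. 0 \<le> E t) at_top"
      using eventually_ge_at_top[of 0] by (rule eventually_mono) (rule E_nonneg)
    show "eventually (\<lambda>t. E t \<le> K / t) at_top"
      using eventually_gt_at_top[of 0] by (rule eventually_mono) (use K(2) in \<open>simp add: field_simps\<close>)
    show "((\<lambda>t. K / t) \<longlongrightarrow> 0) at_top"
      by (rule tendsto_divide_0[OF tendsto_const filterlim_at_top_imp_at_infinity[OF filterlim_ident]])
  qed simp
qed

text \<open>The weight \<open>\<xi> = H(Y)/Y\<close> is nonincreasing, and by convexity \<open>\<xi> x \<le> H x + H(Y)\<close>. Hence \<open>\<xi> M\<close> is absorbed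
  by the dissipation \<open>M'\<close>, which dominates the memory term with kernel \<open>H \<circ> g\<close>, up to a multiple of
  \<open>H(Y) = \<xi> Y\<close>; and \<open>Y\<close> itself satisfies \<open>Y' = - \<beta> \<xi> Y\<close>.\<close>

lemma E_le_ode:
  fixes H H' y :: "real \<Rightarrow> real"
  assumes H: "convex_on {0..} H" "H 0 = 0" "\<And>x. 0 < x \<Longrightarrow> 0 < H x"
    and H': "\<And>x. 0 \<le> x \<Longrightarrow> (H has_real_derivative H' x) (at x within {0..})"
    and gH: "\<And>t. 0 \<le> t \<Longrightarrow> g' t + H (g t) \<le> 0"
    and y: "\<And>t. 0 \<le> t \<Longrightarrow> (y has_real_derivative - H (y t)) (at t within {0..})"
      "\<And>t. 0 \<le> t \<Longrightarrow> 0 \<le> y t" "0 < y 0"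
  shows "\<exists>C>0. \<exists>\<beta>>0. \<exists>\<kappa>>0. \<forall>t>0. E t \<le> C * y (\<beta> * t + \<kappa>)"
proof -
  have H_nonneg: "0 \<le> H x" if "0 \<le> x" for x
    using H(2) H(3)[of x] that by (cases "x = 0") auto
  have y_pos: "0 < y t" if "0 \<le> t" for t
    by (rule convex_ode_positive[OF H(1,2) H_nonneg y that])
  obtain L L' N m K1 where L: "0 < N" "0 < m" "0 < K1"
    "\<And>t. 0 \<le> t \<Longrightarrow> (L has_vector_derivative L' t) (at t within {0..})"
    "\<And>t. 0 \<le> t \<Longrightarrow> L' t \<le> - m * E t + K1 * M t"
    "\<And>t. 0 \<le> t \<Longrightarrow> 0 \<le> L t" "\<And>t. 0 \<le> t \<Longrightarrow> L t \<le> N * E t"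
    by (rule lyapunov, rule that)
  obtain K where K: "0 < K" "\<And>t. 0 \<le> t \<Longrightarrow> integral {0..t} (\<lambda>s. (norm (U t - U s))\<^sup>2) \<le> K"
    using displacement_bounded by blast
  obtain d where d: "0 < d" "\<And>t. 0 \<le> t \<Longrightarrow> E' t \<le> - d * dissipated t - \<sigma> * M' t"
    using E'_le by blast
  \<comment> \<open>As \<open>Y 0 = y 1\<close>, this is the initial and largest value of
    \<open>\<xi>\<close>.\<close>
  define \<xi>0 where "\<xi>0 = H (y 1) / y 1"
  \<comment> \<open>\<open>C2\<close> lets the loss \<open>\<sigma> M'\<close> of the energy cover
    \<open>K1 M'\<close>, \<open>C3\<close> bounds \<open>\<Psi>\<close> by \<open>C3 E\<close>, and
    \<open>a\<close> is the resulting damping rate of \<open>\<Psi>\<close> relative to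
    \<open>\<xi>\<close>.\<close>
  define C2 where "C2 = K1 / \<sigma>"
  define C3 where "C3 = \<xi>0 * N + C2"
  define a where "a = m / C3"
  \<comment> \<open>\<open>Y\<close> decays at half that rate, so one half of
    \<open>a \<Lambda> \<xi> Y\<close> is free to absorb the forcing \<open>K1 K \<xi> Y\<close>;
    hence the factor 2 in \<open>\<Lambda>\<close>.\<close>
  define \<beta> where "\<beta> = a / 2"
  \<comment> \<open>The shift by 1 is the positive constant \<open>\<kappa>\<close> of the
    conclusion.\<close>
  define Y where "Y t = y (\<beta> * t + 1)" for t
  define \<xi> where "\<xi> t = H (Y t) / Y t" for t
  define \<Psi> where "\<Psi> t = \<xi> t * L t + C2 * E t" for t
  define \<Lambda> where "\<Lambda> = max (2 * K1 * K / a) (\<Psi> 0 / Y 0)"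
  have y1: "0 < y 1" by (rule y_pos) simp
  have C: "0 < \<xi>0" "0 < C2" "0 < C3"
    using y1 H(3) L pos by (simp_all add: \<xi>0_def C2_def C3_def add_pos_pos)
  have a: "0 < a" "0 < \<beta>" using L C by (simp_all add: a_def \<beta>_def)
  have \<Lambda>: "0 < \<Lambda>" "2 * K1 * K \<le> a * \<Lambda>"
  proof -
    have "0 < 2 * K1 * K / a" "2 * K1 * K / a \<le> \<Lambda>"
      using L(3) K(1) a(1) by (simp_all add: \<Lambda>_def)
    then show "0 < \<Lambda>" "2 * K1 * K \<le> a * \<Lambda>"
      using a(1) by (linarith, simp add: pos_divide_le_eq mult.commute)
  qed
  have Y_pos: "0 < Y t" if "0 \<le> t" for t
    unfolding Y_def using that a by (intro y_pos) simp
  have Y: "(Y has_real_derivative - \<beta> * H (Y t)) (at t within {0..})" if t: "0 \<le> t" for t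
  proof -
    have "((y \<circ> (\<lambda>t. \<beta> * t + 1)) has_real_derivative - H (y (\<beta> * t + 1)) * \<beta>) (at t within {0..})"
    proof (rule DERIV_image_chain)
      show "(y has_real_derivative - H (y (\<beta> * t + 1))) (at (\<beta> * t + 1) within (\<lambda>t. \<beta> * t + 1) ` {0..})"
        using a t by (intro DERIV_subset[OF y(1)]) auto
      show "((\<lambda>t. \<beta> * t + 1) has_real_derivative \<beta>) (at t within {0..})"
        by (auto intro!: derivative_eq_intros)
    qed
    then show ?thesis by (simp add: Y_def[abs_def] o_def mult.commute)
  qed
  define \<xi>' where "\<xi>' t = - \<beta> * H (Y t) * (H' (Y t) * Y t - H (Y t)) / (Y t)\<^sup>2" for t
  have \<xi>: "(\<xi> has_real_derivative \<xi>' t) (at t within {0..})" if t: "0 \<le> t" for t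
  proof -
    have "(H has_real_derivative H' (Y t)) (at (Y t) within Y ` {0..})"
      using Y_pos t by (intro DERIV_subset[OF H']) (auto intro: less_imp_le)
    then have "((H \<circ> Y) has_real_derivative H' (Y t) * (- \<beta> * H (Y t))) (at t within {0..})"
      by (rule DERIV_image_chain[OF _ Y[OF t]])
    from DERIV_divide[OF this Y[OF t]]
    have "((\<lambda>t. (H \<circ> Y) t / Y t) has_real_derivative
        (H' (Y t) * (- \<beta> * H (Y t)) * Y t - (H \<circ> Y) t * (- \<beta> * H (Y t))) / (Y t * Y t)) (at t within {0..})"
      using Y_pos[OF t] by simp
    moreover have "(H' (Y t) * (- \<beta> * H (Y t)) * Y t - (H \<circ> Y) t * (- \<beta> * H (Y t))) / (Y t * Y t) = \<xi>' t"
      by (simp add: \<xi>'_def power2_eq_square right_diff_distrib mult_ac)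
    ultimately show ?thesis by (simp add: \<xi>_def[abs_def])
  qed
  have \<xi>'_nonpos: "\<xi>' t \<le> 0" if t: "0 \<le> t" for t
  proof -
    \<comment> \<open>The tangent at \<open>Y t\<close>, evaluated at 0, shows that
      \<open>H x / x\<close> has nonnegative derivative at \<open>Y t\<close>; and \<open>Y\<close>
      is nonincreasing.\<close>
    have "H 0 - H (Y t) \<ge> H' (Y t) * (0 - Y t)"
      using Y_pos[OF t] H'[of "Y t"]
      by (intro convex_on_imp_above_tangent[OF H(1)]) (auto simp: interior_real_atLeast)
    then have "0 \<le> H' (Y t) * Y t - H (Y t)" using H(2) by simp
    then have "0 \<le> \<beta> * H (Y t) * (H' (Y t) * Y t - H (Y t)) / (Y t)\<^sup>2"
      using a H_nonneg[of "Y t"] Y_pos[OF t] by simp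
    then show ?thesis by (simp add: \<xi>'_def)
  qed
  have \<xi>_bounds: "0 \<le> \<xi> t" "\<xi> t \<le> \<xi>0" if t: "0 \<le> t" for t
  proof -
    show "0 \<le> \<xi> t" using H_nonneg[of "Y t"] Y_pos[OF t] by (simp add: \<xi>_def)
    have "\<xi> t \<le> \<xi> 0"
      using nonincreasing_atLeast[of \<xi> \<xi>' 0 t] \<xi> \<xi>'_nonpos t
      by (simp add: has_real_derivative_iff_has_vector_derivative)
    then show "\<xi> t \<le> \<xi>0" by (simp add: \<xi>0_def \<xi>_def Y_def)
  qed
  have HY: "H (Y t) = \<xi> t * Y t" if "0 \<le> t" for t
    using Y_pos[OF that] by (simp add: \<xi>_def)
  have memory: "\<xi> t * M t \<le> M' t + K * (\<xi> t * Y t)" if t: "0 \<le> t" for t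
  proof -
    have ints: "(\<lambda>s. g (t - s) * (norm (U t - U s))\<^sup>2) integrable_on {0..t}"
      "(\<lambda>s. - g' (t - s) * (norm (U t - U s))\<^sup>2) integrable_on {0..t}"
      "(\<lambda>s. (norm (U t - U s))\<^sup>2) integrable_on {0..t}"
      by (intro integrable_continuous_interval continuous_on_mult continuous_on_power continuous_on_norm
          continuous_on_diff continuous_on_const continuous_on_minus continuous_on_memory[OF g_cont U_cont]
          continuous_on_memory[OF g' U_cont])+
    have HY_int: "(\<lambda>s. H (Y t) * (norm (U t - U s))\<^sup>2) integrable_on {0..t}"
      using ints(3) by (rule integrable_on_mult_right)
    have "\<xi> t * M t = integral {0..t} (\<lambda>s. \<xi> t * (g (t - s) * (norm (U t - U s))\<^sup>2))"
      by (simp add: M_def memory_circ_def)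
    also have "\<dots> \<le> integral {0..t} (\<lambda>s. - g' (t - s) * (norm (U t - U s))\<^sup>2 + H (Y t) * (norm (U t - U s))\<^sup>2)"
    proof (rule integral_le)
      show "\<xi> t * (g (t - s) * (norm (U t - U s))\<^sup>2) \<le>
          - g' (t - s) * (norm (U t - U s))\<^sup>2 + H (Y t) * (norm (U t - U s))\<^sup>2" if s: "s \<in> {0..t}" for s
      proof -
        \<comment> \<open>Convexity acts on each kernel value separately, so the level
          \<open>H (Y t)\<close> comes out as a factor of the unweighted displacement
          integral.\<close>
        have "\<xi> t * g (t - s) \<le> H (g (t - s)) + H (Y t)"
          unfolding \<xi>_def using s g_pos[of "t - s"]
          by (intro convex_chord_mult_le H(1,2) H_nonneg Y_pos t) auto
        also have "\<dots> \<le> - g' (t - s) + H (Y t)"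
          using gH[of "t - s"] s by simp
        finally have "\<xi> t * g (t - s) * (norm (U t - U s))\<^sup>2 \<le> (- g' (t - s) + H (Y t)) * (norm (U t - U s))\<^sup>2"
          by (rule mult_right_mono) simp
        then show ?thesis by (simp only: distrib_right mult.assoc)
      qed
      show "(\<lambda>s. \<xi> t * (g (t - s) * (norm (U t - U s))\<^sup>2)) integrable_on {0..t}"
        using ints(1) by (rule integrable_on_mult_right)
      show "(\<lambda>s. - g' (t - s) * (norm (U t - U s))\<^sup>2 + H (Y t) * (norm (U t - U s))\<^sup>2) integrable_on {0..t}"
        by (rule integrable_add[OF ints(2) HY_int])
    qed
    also have "\<dots> = M' t + H (Y t) * integral {0..t} (\<lambda>s. (norm (U t - U s))\<^sup>2)"
      unfolding Henstock_Kurzweil_Integration.integral_add[OF ints(2) HY_int]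
      by (simp add: M'_def memory_circ_def)
    also have "\<dots> \<le> M' t + H (Y t) * K"
      using K(2)[OF t] H_nonneg[of "Y t"] Y_pos[OF t] by (intro add_left_mono mult_left_mono) auto
    finally show ?thesis by (simp add: HY[OF t] mult.commute)
  qed
  have nonpos: "\<Psi> t - \<Lambda> * Y t \<le> 0" if t: "0 \<le> t" for t
  proof (rule differential_inequality_nonpos[where f = "\<lambda>t. \<Psi> t - \<Lambda> * Y t" and \<xi> = "\<lambda>t. a * \<xi> t"
        and f' = "\<lambda>t. (\<xi> t * L' t + \<xi>' t * L t) + C2 * E' t - \<Lambda> * (- \<beta> * H (Y t))"])
    show "((\<lambda>t. \<Psi> t - \<Lambda> * Y t) has_real_derivative
        (\<xi> t * L' t + \<xi>' t * L t) + C2 * E' t - \<Lambda> * (- \<beta> * H (Y t))) (at t within {0..})" if "0 \<le> t" for t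
      unfolding \<Psi>_def[abs_def]
      by (intro DERIV_diff DERIV_add DERIV_cmult DERIV_mult' \<xi> Y that
          L(4)[folded has_real_derivative_iff_has_vector_derivative]
          E[folded has_real_derivative_iff_has_vector_derivative])
    show "continuous_on {0..} (\<lambda>t. a * \<xi> t)"
      using \<xi> by (intro continuous_intros DERIV_continuous_on) auto
    have "\<Psi> 0 / Y 0 \<le> \<Lambda>" by (simp add: \<Lambda>_def)
    then show "\<Psi> 0 - \<Lambda> * Y 0 \<le> 0" using Y_pos[of 0] by (simp add: field_simps)
    fix t :: real assume t: "0 \<le> t"
    have 1: "\<xi> t * L' t \<le> \<xi> t * (- m * E t + K1 * M t)"
      using L(5)[OF t] \<xi>_bounds[OF t] by (intro mult_left_mono)
    have 2: "K1 * (\<xi> t * M t) \<le> K1 * (M' t + K * (\<xi> t * Y t))"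
      using memory[OF t] L(3) by (intro mult_left_mono) auto
    have "0 \<le> d * dissipated t" using d dissipated_nonneg by simp
    then have "\<sigma> * M' t \<le> - E' t" using d(2)[OF t] by linarith
    then have "C2 * (\<sigma> * M' t) \<le> C2 * (- E' t)"
      using C by (intro mult_left_mono) auto
    then have 3: "K1 * M' t \<le> - (C2 * E' t)"
      using pos by (simp add: C2_def)
    have 4: "\<xi>' t * L t \<le> 0"
      using \<xi>'_nonpos[OF t] L(6)[OF t] by (rule mult_nonpos_nonneg)
    have "\<Psi> t \<le> \<xi>0 * (N * E t) + C2 * E t"
      unfolding \<Psi>_def using \<xi>_bounds[OF t] L(6,7)[OF t] C by (intro add_right_mono mult_mono) auto
    then have "\<Psi> t \<le> C3 * E t" by (simp add: C3_def algebra_simps)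
    then have "a * \<Psi> t \<le> m * E t"
      using mult_left_mono[of "\<Psi> t" "C3 * E t" a] a C by (simp add: a_def)
    then have 5: "\<xi> t * (a * \<Psi> t) \<le> \<xi> t * (m * E t)"
      using \<xi>_bounds[OF t] by (intro mult_left_mono)
    have 6: "2 * K1 * K * (\<xi> t * Y t) \<le> a * \<Lambda> * (\<xi> t * Y t)"
      using \<xi>_bounds[OF t] Y_pos[OF t] \<Lambda> by (intro mult_right_mono) auto
    have 7: "\<Lambda> * (- \<beta> * H (Y t)) = - (a * \<Lambda> * (\<xi> t * Y t)) / 2"
      by (simp add: HY[OF t] \<beta>_def)
    show "(\<xi> t * L' t + \<xi>' t * L t) + C2 * E' t - \<Lambda> * (- \<beta> * H (Y t)) \<le> - (a * \<xi> t) * (\<Psi> t - \<Lambda> * Y t)"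
    proof -
      have "- (a * \<xi> t) * (\<Psi> t - \<Lambda> * Y t) = - (\<xi> t * (a * \<Psi> t)) + a * \<Lambda> * (\<xi> t * Y t)"
        "\<xi> t * (- m * E t + K1 * M t) = - (\<xi> t * (m * E t)) + K1 * (\<xi> t * M t)"
        "K1 * (M' t + K * (\<xi> t * Y t)) = K1 * M' t + K1 * K * (\<xi> t * Y t)"
        by (simp_all add: algebra_simps)
      then show ?thesis using 1 2 3 4 5 6 7 by linarith
    qed
  qed (use t in auto)
  have "E t \<le> \<Lambda> / C2 * y (\<beta> * t + 1)" if "0 \<le> t" for t
  proof -
    have "0 \<le> \<xi> t * L t" using \<xi>_bounds[OF that] L(6)[OF that] by simp
    then have "C2 * E t \<le> \<Lambda> * Y t" using nonpos[OF that] by (simp add: \<Psi>_def)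
    then show ?thesis using C by (simp add: Y_def field_simps)
  qed
  then show ?thesis
    using \<Lambda> C a by (intro exI[of _ "\<Lambda> / C2"] conjI exI[of _ \<beta>] exI[of _ 1]) auto
qed

end

section \<open>The decay theorem\<close>

theorem theorem1p4:
  fixes DA DS :: "'a::{real_inner, complete_space} set"
    and A S :: "'a \<Rightarrow> 'a"
    and \<tau> \<alpha> b c \<gamma> \<alpha>\<^sub>0 \<delta> lam0 k \<sigma> :: real
    and g H y :: "real \<Rightarrow> real"
    and u0 u1 u2 :: 'a
    and u :: "real \<Rightarrow> 'a"
  assumes A_pos: "positive_self_adjoint DA A"
    and S_sqrt: "operator_sqrt DA A DS S"
    and coeffs_pos: "\<tau> > 0" "\<alpha> > 0" "b > 0" "c > 0"
    and gamma: "\<gamma> = \<alpha> - c\<^sup>2 * \<tau> / b"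
    and g_C1: "Ck_on 1 {0..} g"
    and g_pos: "\<And>t. t \<ge> 0 \<Longrightarrow> g t > 0"
    and g_0: "g 0 < b * \<alpha> * \<gamma> / \<tau>\<^sup>2"
    and G_inf: "\<exists>Ginf. (memory_integral g \<longlongrightarrow> Ginf) at_top \<and> Ginf < c\<^sup>2"
    and H_C1: "Ck_on 1 {0..} H"
    and H_convex: "convex_on {0..} H"
    and H_mono: "strict_mono_on {0..} H"
    and H_0: "H 0 = 0"
    and g_H: "\<And>t. t > 0 \<Longrightarrow> derivative_on {0..} g t + H (g t) \<le> 0"
    and y_nonneg: "\<And>t. t \<ge> 0 \<Longrightarrow> y t \<ge> 0"
    and y_ode: "\<And>t. t \<ge> 0 \<Longrightarrow> (y has_real_derivative - H (y t)) (at t within {0..})"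
    and y_0: "y 0 = g 0"
    and alpha0: "0 < \<alpha>\<^sub>0" "\<alpha>\<^sub>0 < 1"
    and y_L1: "set_integrable lborel {0..} (\<lambda>t. y t powr (1 - \<alpha>\<^sub>0))"
    and delta: "\<delta> > 0"
    and H_C2: "Ck_on 2 {0<..<\<delta>} H"
    and H_ineq: "\<And>x. x \<in> {0<..<\<delta>} \<Longrightarrow>
        x\<^sup>2 * derivative_on {0<..<\<delta>} (derivative_on {0<..<\<delta>} H) x
          - x * derivative_on {0<..<\<delta>} H x + H x \<ge> 0"
    and lam0_pos: "lam0 > 0"
    and poincare: "\<And>v. v \<in> DS \<Longrightarrow> norm v \<le> lam0 * norm (S v)"
    and gamma_pos: "\<gamma> > 0"
    and k: "c\<^sup>2 / b < k" "k < \<alpha> / \<tau>"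
    and sigma: "0 < \<sigma>" "\<sigma> < k" "g 0 < (k - \<sigma>) * (b * k - c\<^sup>2)"
    and data: "u0 \<in> DS" "u1 \<in> DS"
    and sol: "weak_solution \<tau> \<alpha> b c g DS S u0 u1 u2 u"
  shows "(energy \<tau> \<alpha> b c k g S u \<longlongrightarrow> 0) at_top \<and>
    (\<exists>C>0. \<exists>\<beta>>0. \<exists>\<kappa>>0. \<forall>t>0. energy \<tau> \<alpha> b c k g S u t \<le> C * y (\<beta> * t + \<kappa>))"
proof -
  define ut where "ut = derivative_on {0..} u"
  define utt where "utt = derivative_on {0..} ut"
  define g' where "g' = derivative_on {0..} g"
  have DS: "subspace DS" and S_add: "\<And>x y. x \<in> DS \<Longrightarrow> y \<in> DS \<Longrightarrow> S (x + y) = S x + S y"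
    and S_scale: "\<And>r x. x \<in> DS \<Longrightarrow> S (r *\<^sub>R x) = r *\<^sub>R S x"
    using S_sqrt unfolding operator_sqrt_def positive_self_adjoint_def self_adjoint_operator_def
      linear_operator_on_def by auto
  have S_diff: "S (x - y) = S x - S y" if "x \<in> DS" "y \<in> DS" for x y
    using S_add[of x "(-1) *\<^sub>R y"] S_scale[of y "-1"] subspace_scale[OF DS, of y "-1"] that by simp
  have u_dom: "C1_into_domain DS S u" and u_C2: "Ck_on 2 {0..} u"
    and u_eq: "\<And>v \<phi>. v \<in> DS \<Longrightarrow> test_function \<phi> \<Longrightarrow>
          - \<tau> * integral {0<..} (\<lambda>t. (utt t \<bullet> v) * deriv \<phi> t)
          + integral {0<..} (\<lambda>t.
              (\<alpha> * (utt t \<bullet> v) + c\<^sup>2 * (S (u t) \<bullet> S v) + b * (S (ut t) \<bullet> S v)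
               - integral {0..t} (\<lambda>s. g (t - s) * (S (u s) \<bullet> S v))) * \<phi> t) = 0"
    using sol unfolding weak_solution_def Let_def ut_def utt_def by blast+
  have mem: "u t \<in> DS" "ut t \<in> DS" if "0 \<le> t" for t
    using u_dom that unfolding C1_into_domain_def ut_def by blast+
  have pair: "((\<lambda>s. (u s, S (u s))) has_vector_derivative (ut t, S (ut t))) (at t within {0..})" if "0 \<le> t" for t
    using u_dom that unfolding C1_into_domain_def ut_def by blast
  have u: "(u has_vector_derivative ut t) (at t within {0..})" if "0 \<le> t" for t
    using bounded_linear.has_vector_derivative[OF bounded_linear_fst pair[OF that]] by simp
  have U: "((\<lambda>s. S (u s)) has_vector_derivative S (ut t)) (at t within {0..})" if "0 \<le> t" for t
    using bounded_linear.has_vector_derivative[OF bounded_linear_snd pair[OF that]] by simp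
  have "continuous_on {0..} (\<lambda>t. (ut t, S (ut t)))"
    using u_dom unfolding C1_into_domain_def ut_def by blast
  from continuous_on_snd[OF this] have U1: "continuous_on {0..} (\<lambda>t. S (ut t))" by simp
  have ut: "(ut has_vector_derivative utt t) (at t within {0..})" if "0 \<le> t" for t
    using u_C2 that by (simp add: numeral_2_eq_2 differentiable_on_def ut_def[symmetric] utt_def derivative_on_def
        vector_derivative_works[symmetric])
  have utt: "continuous_on {0..} utt"
    using u_C2 by (simp add: numeral_2_eq_2 ut_def utt_def)
  have g: "(g has_vector_derivative g' t) (at t within {0..})" if "0 \<le> t" for t
    using g_C1 that by (simp add: differentiable_on_def g'_def derivative_on_def vector_derivative_works[symmetric])
  have g': "continuous_on {0..} g'"
    using g_C1 by (simp add: g'_def)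
  have g_cont: "continuous_on {0..} g"
    using g by (intro continuous_on_vector_derivative) auto
  define H' where "H' = derivative_on {0..} H"
  have H': "(H has_real_derivative H' x) (at x within {0..})" if "0 \<le> x" for x
    using H_C1 that by (simp add: differentiable_on_def H'_def derivative_on_def
        has_real_derivative_iff_has_vector_derivative vector_derivative_works[symmetric])
  have H_pos: "0 < H x" if "0 < x" for x
    using strict_mono_onD[OF H_mono, of 0 x] H_0 that by simp
  have H_cont: "continuous_on {0..} H"
    using H' by (intro DERIV_continuous_on) auto
  have gH: "g' t + H (g t) \<le> 0" if t: "0 \<le> t" for t
  proof (cases "t = 0")
    case True
    \<comment> \<open>The inequality is assumed for positive times; at 0 it is inherited by
      continuity.\<close>
    have "continuous_on {0..} (\<lambda>t. g' t + H (g t))"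
      using g_pos by (intro continuous_intros g' continuous_on_compose2[OF H_cont g_cont]) (auto intro: less_imp_le)
    then have "((\<lambda>t. g' t + H (g t)) \<longlongrightarrow> g' 0 + H (g 0)) (at 0 within {0..})"
      by (auto simp: continuous_on_def)
    then have "((\<lambda>t. g' t + H (g t)) \<longlongrightarrow> g' 0 + H (g 0)) (at_right 0)"
      by (rule tendsto_within_subset) auto
    moreover have "eventually (\<lambda>t. g' t + H (g t) \<le> 0) (at_right 0)"
      using eventually_at_right_less by (rule eventually_mono) (use g_H in \<open>simp add: g'_def\<close>)
    ultimately have "g' 0 + H (g 0) \<le> 0"
      by (intro tendsto_upperbound) auto
    then show ?thesis using True by simp
  next
    case False
    then show ?thesis using g_H[of t] t by (simp add: g'_def)
  qed
  have g'_le: "g' t \<le> 0" if "0 \<le> t" for t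
    using gH[OF that] H_pos[OF g_pos[OF that]] by simp
  obtain Ginf where Ginf: "(memory_integral g \<longlongrightarrow> Ginf) at_top" "Ginf < c\<^sup>2"
    using G_inf by blast
  \<comment> \<open>The maximum with \<open>c\<^sup>2 / 2\<close> makes the bound visibly positive
    and keeps it below \<open>c\<^sup>2\<close>.\<close>
  have G_le: "memory_integral g t \<le> max Ginf (c\<^sup>2 / 2)" if t: "0 \<le> t" for t
  proof -
    have "memory_integral g t \<le> memory_integral g s" if "t \<le> s" for s
      unfolding memory_integral_def using t that g_pos
      by (intro integral_subset_le integrable_continuous_interval continuous_on_subset[OF g_cont])
        (auto intro: less_imp_le)
    then have "memory_integral g t \<le> Ginf"
      by (intro tendsto_lowerbound[OF Ginf(1)] eventually_mono[OF eventually_ge_at_top[of t]]) auto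
    then show ?thesis by simp
  qed
  \<comment> \<open>The graph of \<open>S\<close>, transported to the copy. Test vectors and their
    images form one linear subspace, so a difference quotient is admissible together with its
    image.\<close>
  define D where "D = (\<lambda>v. (to_hil v, to_hil (S v))) ` DS"
  have D_I: "(to_hil v, to_hil (S v)) \<in> D" if "v \<in> DS" for v
    using that by (auto simp: D_def)
  have lift: "((\<lambda>t. to_hil (f t)) has_vector_derivative to_hil d) (at t within {0..})"
    if "(f has_vector_derivative d) (at t within {0..})" for f :: "real \<Rightarrow> 'a" and d t
    by (rule bounded_linear.has_vector_derivative[OF bounded_linear_to_hil that])
  have lift_cont: "continuous_on {0..} (\<lambda>t. to_hil (f t))"
    if "continuous_on {0..} f" for f :: "real \<Rightarrow> 'a"
    by (rule bounded_linear.continuous_on[OF bounded_linear_to_hil that])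
  have U_cont: "continuous_on {0..} (\<lambda>t. to_hil (S (u t)))"
    using U by (intro lift_cont continuous_on_vector_derivative) auto
  have convol: "convol g (\<lambda>s. to_hil (S (u s))) t \<bullet> to_hil x = integral {0..t} (\<lambda>s. g (t - s) * (S (u s) \<bullet> x))" for t x
    using integral_linear[OF convol_integrable[OF g_cont U_cont] bounded_linear_inner_left[of "to_hil x"], of t]
    by (simp add: convol_def o_def)
  interpret mgt_trajectory \<tau> \<alpha> b c k \<sigma> lam0 "max Ginf (c\<^sup>2 / 2)" g g' D "\<lambda>t. to_hil (u t)"
    "\<lambda>t. to_hil (ut t)" "\<lambda>t. to_hil (utt t)" "\<lambda>t. to_hil (S (u t))" "\<lambda>t. to_hil (S (ut t))"
  proof
    show "0 < \<tau>" "0 < \<alpha>" "0 < b" "0 < lam0" "0 < \<sigma>" "\<sigma> < k" "g 0 < (k - \<sigma>) * (b * k - c\<^sup>2)"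
      using coeffs_pos lam0_pos sigma by auto
    show "c\<^sup>2 < b * k" "\<tau> * k < \<alpha>"
      using k coeffs_pos by (simp_all add: field_simps)
    show "0 < max Ginf (c\<^sup>2 / 2)" "max Ginf (c\<^sup>2 / 2) < c\<^sup>2"
      using Ginf(2) coeffs_pos by (auto simp: less_max_iff_disj)
    show "subspace D"
      unfolding D_def
    proof (rule subspaceI)
      show "0 \<in> (\<lambda>v. (to_hil v, to_hil (S v))) ` DS"
        using subspace_0[OF DS] S_scale[of 0 0] by (auto simp: image_iff zero_prod_def to_hil_0 intro!: bexI[of _ 0])
    next
      fix x y assume "x \<in> (\<lambda>v. (to_hil v, to_hil (S v))) ` DS" "y \<in> (\<lambda>v. (to_hil v, to_hil (S v))) ` DS"
      then obtain v w where "v \<in> DS" "w \<in> DS" "x = (to_hil v, to_hil (S v))" "y = (to_hil w, to_hil (S w))"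
        by blast
      then show "x + y \<in> (\<lambda>v. (to_hil v, to_hil (S v))) ` DS"
        using subspace_add[OF DS] S_add by (auto intro!: image_eqI[of _ _ "v + w"])
    next
      fix r x assume "x \<in> (\<lambda>v. (to_hil v, to_hil (S v))) ` DS"
      then obtain v where "v \<in> DS" "x = (to_hil v, to_hil (S v))"
        by blast
      then show "r *\<^sub>R x \<in> (\<lambda>v. (to_hil v, to_hil (S v))) ` DS"
        using subspace_scale[OF DS] S_scale by (auto intro!: image_eqI[of _ _ "r *\<^sub>R v"])
    qed
    show "norm v \<le> lam0 * norm V" if "(v, V) \<in> D" for v V
      using that poincare by (auto simp: D_def)
    show "((\<lambda>t. \<tau> * (to_hil (utt t) \<bullet> v)) has_vector_derivative
        (- \<alpha> *\<^sub>R to_hil (utt t)) \<bullet> v - (c\<^sup>2 *\<^sub>R to_hil (S (u t)) + b *\<^sub>R to_hil (S (ut t))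
          - convol g (\<lambda>t. to_hil (S (u t))) t) \<bullet> V) (at t within {0..})"
      if vV: "(v, V) \<in> D" and t: "0 \<le> t" for v V t
    proof -
      obtain x where x: "x \<in> DS" "v = to_hil x" "V = to_hil (S x)"
        using vV by (auto simp: D_def)
      define h where "h t = \<alpha> * (utt t \<bullet> x) + c\<^sup>2 * (S (u t) \<bullet> S x) + b * (S (ut t) \<bullet> S x)
               - integral {0..t} (\<lambda>s. g (t - s) * (S (u s) \<bullet> S x))" for t
      \<comment> \<open>For a fixed test vector the equation becomes classical because
        \<open>h\<close> is continuous; for its memory part this is seen by reading it as a
        convolution.\<close>
      have "((\<lambda>t. \<tau> * (utt t \<bullet> x)) has_vector_derivative - h t) (at t within {0..})"
      proof (rule distributional_derivative_imp_derivative[OF _ _ _ t])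
        show "continuous_on {0..} (\<lambda>t. \<tau> * (utt t \<bullet> x))"
          by (intro continuous_intros utt)
        have "continuous_on {0..} (\<lambda>t. S (u t))"
          using U by (intro continuous_on_vector_derivative) auto
        then show "continuous_on {0..} h"
          unfolding h_def[abs_def] convol[symmetric]
          by (intro continuous_intros utt U1 continuous_on_convol g_cont U_cont)
        show "- integral {0<..} (\<lambda>t. \<tau> * (utt t \<bullet> x) * deriv \<phi> t) + integral {0<..} (\<lambda>t. h t * \<phi> t) = 0"
          if "test_function \<phi>" for \<phi>
          using u_eq[OF x(1) that] by (simp add: h_def mult.assoc)
      qed
      then show ?thesis
        by (simp add: x h_def convol inner_add_left inner_diff_left algebra_simps)
    qed
    fix t :: real assume t: "0 \<le> t"
    show "(to_hil (u t), to_hil (S (u t))) \<in> D" "(to_hil (ut t), to_hil (S (ut t))) \<in> D"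
      by (rule D_I, rule mem[OF t])+
    show "((\<lambda>t. to_hil (u t)) has_vector_derivative to_hil (ut t)) (at t within {0..})"
      "((\<lambda>t. to_hil (ut t)) has_vector_derivative to_hil (utt t)) (at t within {0..})"
      "((\<lambda>t. to_hil (S (u t))) has_vector_derivative to_hil (S (ut t))) (at t within {0..})"
      by (rule lift, rule u ut U, rule t)+
    show "(g has_vector_derivative g' t) (at t within {0..})" by (rule g[OF t])
    show "0 < g t" by (rule g_pos[OF t])
    show "g' t \<le> 0" by (rule g'_le[OF t])
    show "memory_integral g t \<le> max Ginf (c\<^sup>2 / 2)" by (rule G_le[OF t])
  next
    show "continuous_on {0..} g'" by (rule g')
    show "continuous_on {0..} (\<lambda>t. to_hil (utt t))" by (rule lift_cont[OF utt])
    show "continuous_on {0..} (\<lambda>t. to_hil (S (ut t)))" by (rule lift_cont[OF U1])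
  qed
  \<comment> \<open>Restricted to nonnegative times, where the trajectory lies in \<open>DS\<close>
    and \<open>S\<close> respects differences.\<close>
  have energy_eq: "energy \<tau> \<alpha> b c k g S u t = E t" if "0 \<le> t" for t
  proof -
    have "integral {0..t} (\<lambda>s. g (t - s) * (S (u t - u s) \<bullet> S (ut t))) =
        integral {0..t} (\<lambda>s. g (t - s) * ((to_hil (S (u t)) - to_hil (S (u s))) \<bullet> to_hil (S (ut t))))"
      using mem that by (intro integral_cong) (simp add: S_diff inner_diff_left)
    moreover have "memory_circ g (\<lambda>s. S (u s)) t = memory_circ g (\<lambda>s. to_hil (S (u s))) t"
      unfolding memory_circ_def by (metis of_hil_simps(5,6))
    moreover have "norm (utt t + k *\<^sub>R ut t) = norm (to_hil (utt t) + k *\<^sub>R to_hil (ut t))"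
      by (metis of_hil_simps(3,4,6))
    ultimately show ?thesis
      by (simp add: energy_def E_def Let_def ut_def[symmetric] utt_def[symmetric])
  qed
  have "(energy \<tau> \<alpha> b c k g S u \<longlongrightarrow> 0) at_top"
  proof (rule Lim_transform_eventually[OF E_tendsto_0])
    show "eventually (\<lambda>t. E t = energy \<tau> \<alpha> b c k g S u t) at_top"
      using eventually_ge_at_top[of 0] by (rule eventually_mono) (simp add: energy_eq)
  qed
  moreover have "\<exists>C>0. \<exists>\<beta>>0. \<exists>\<kappa>>0. \<forall>t>0. E t \<le> C * y (\<beta> * t + \<kappa>)"
    by (rule E_le_ode[OF H_convex H_0 H_pos H' gH y_ode y_nonneg]) (use y_0 g_pos[of 0] in auto)
  ultimately show ?thesis
    by (simp add: energy_eq)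
qed

end
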